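(* There are constants $0<k<K$ such that for all $\kappa,d>0$: if $\kappa d<k$ then $I'(0)>0$, while if $\kappa d>K$ then $I'(0)<0$.
   Context: Let $\kappa,d>0$. For each $c\in\mathbb R$ there is a unique $h=h(c)>0$ such that the linear problem $$\psi_0''=\kappa^2\bigl(h^2(x+c)^2-1\bigr)\psi_0\ \text{ on }[-d,d],\qquad \psi_0(-d)=1,\quad \psi_0'(\pm d)=0$$ has a positive solution $\psi_0$, and this positive solution is unique (this is standard linear theory). With this $h=h(c)$ and $\psi_0=\psi_0(\cdot\,;c)$ define $$I(c)=\int_{-d}^{d}(x+c)\,\psi_0(x)^2\,dx ,$$ and let $I'(0)$ be the derivative of $I$ with respect to $c$ at $c=0$, for fixed $\kappa,d$. *)

theory Defs
  imports "HOL-Analysis.Analysis"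
begin

(* Derivatives are taken within [-d,d], hence one-sided at the end points. *)
definition positive_solution ::
  "real \<Rightarrow> real \<Rightarrow> real \<Rightarrow> real \<Rightarrow> (real \<Rightarrow> real) \<Rightarrow> bool" where
  "positive_solution \<kappa> d h c \<psi> \<longleftrightarrow>
     (\<exists>\<psi>'. (\<forall>x\<in>{-d..d}. (\<psi> has_real_derivative \<psi>' x) (at x within {-d..d})) \<and>
           (\<forall>x\<in>{-d..d}. (\<psi>' has_real_derivative \<kappa>\<^sup>2 * (h\<^sup>2 * (x + c)\<^sup>2 - 1) * \<psi> x)
                          (at x within {-d..d})) \<and>
           \<psi> (-d) = 1 \<and> \<psi>' (-d) = 0 \<and> \<psi>' d = 0) \<and>
     (\<forall>x\<in>{-d..d}. \<psi> x > 0)"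

definition crit_h :: "real \<Rightarrow> real \<Rightarrow> real \<Rightarrow> real" where
  "crit_h \<kappa> d c = (THE h. h > 0 \<and> (\<exists>\<psi>. positive_solution \<kappa> d h c \<psi>))"

(* A solution is determined only on [-d,d]; extensionality fixes its values elsewhere,
   so that the description below is genuinely unique as a function on the reals. *)
definition psi0 :: "real \<Rightarrow> real \<Rightarrow> real \<Rightarrow> real \<Rightarrow> real" where
  "psi0 \<kappa> d c =
     (THE \<psi>. positive_solution \<kappa> d (crit_h \<kappa> d c) c \<psi> \<and> \<psi> \<in> extensional {-d..d})"

definition I_fun :: "real \<Rightarrow> real \<Rightarrow> real \<Rightarrow> real" where
  "I_fun \<kappa> d c = integral {-d..d} (\<lambda>x. (x + c) * (psi0 \<kappa> d c x)\<^sup>2)"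

end

theory Submission
  imports Defs
begin

text \<open>
  Write \<open>V x = \<kappa>\<^sup>2 (h\<^sup>2 x\<^sup>2 - 1)\<close> with \<open>h = h(0)\<close>, let \<open>p\<close> be the (even) positive solution for
  \<open>c = 0\<close> and \<open>w\<close> the odd solution of \<open>w'' = V w\<close> with \<open>w'(0) = 1\<close>. The function
  \<open>X = p' + B w\<close>, with \<open>B\<close> chosen so that \<open>X'(\<plusminus>d) = 0\<close>, is the odd part of the derivative of
  \<open>psi0\<close> in \<open>c\<close>; pairing it with the exact perturbed solution replaces differentiability in the
  parameter by Lipschitz bounds. The integral of \<open>p\<^sup>2 + 2 x X p\<close> has an explicit antiderivative, and
  with \<open>p(d) = 1\<close>, so that \<open>w'(d) = p(0)\<close>, one gets
  \<open>I'(0) = 2 (d - V(d)\<^sup>2 w(d) / (\<kappa>\<^sup>2 h\<^sup>2 p(0)))\<close>.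
  Always \<open>3 \<le> h\<^sup>2 d\<^sup>2\<close>. If \<open>\<kappa> d\<close> is small then \<open>h\<^sup>2 d\<^sup>2 \<le> 6\<close>, and \<open>w(d) \<le> p(0) d\<close> makes the bracket
  positive; if \<open>\<kappa> d\<close> is large then \<open>w(d)\<close> is at least of order \<open>p(0) V(d)\<^sup>-\<^sup>1\<^sup>/\<^sup>2\<close>, which makes
  it negative.
\<close>

subsection \<open>Linear second-order equations\<close>

text \<open>Taylor coefficients of the solution of \<open>u'' = (v0 + v1 t + v2 t^2) u\<close> with
  \<open>u(0) = A\<close>, \<open>u'(0) = B\<close>. The conditionals put zero for coefficients of
  negative index, which truncated subtraction would confuse with index 0.\<close>

fun quadratic_coeff :: "real \<Rightarrow> real \<Rightarrow> real \<Rightarrow> real \<Rightarrow> real \<Rightarrow> nat \<Rightarrow> real" where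
  "quadratic_coeff v0 v1 v2 A B 0 = A"
| "quadratic_coeff v0 v1 v2 A B (Suc 0) = B"
| "quadratic_coeff v0 v1 v2 A B (Suc (Suc n)) =
     (v0 * quadratic_coeff v0 v1 v2 A B n
      + (if 1 \<le> n then v1 * quadratic_coeff v0 v1 v2 A B (n - 1) else 0)
      + (if 2 \<le> n then v2 * quadratic_coeff v0 v1 v2 A B (n - 2) else 0))
     / (real (n + 1) * real (n + 2))"

text \<open>The divisor in the recurrence eventually exceeds any constant, so from some index on a
  weighted coefficient obeys whatever bound holds for the earlier ones.\<close>

lemma quadratic_coeff_bounded:
  fixes R :: real
  assumes R: "R \<ge> 1"
  shows "\<exists>K. \<forall>n. \<bar>quadratic_coeff v0 v1 v2 A B n\<bar> * R ^ n \<le> K"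
proof -
  define a where "a = quadratic_coeff v0 v1 v2 A B"
  \<comment> \<open>The longest jump of the recurrence spans four indices and costs
    \<open>R ^ 4\<close>; as \<open>R \<ge> 1\<close>, this also covers the jumps by two and by
    three.\<close>
  define M where "M = (\<bar>v0\<bar> + \<bar>v1\<bar> + \<bar>v2\<bar>) * R ^ 4"
  obtain N where N: "real N \<ge> M" using real_arch_simple by blast
  \<comment> \<open>A sum of nonnegative terms bounds each of them, which settles the indices up to
    \<open>Suc N\<close>; beyond these the divisor is at least \<open>M\<close>.\<close>
  define K where "K = (\<Sum>i\<le>Suc N. \<bar>a i\<bar> * R ^ i)"
  have K0: "K \<ge> 0" unfolding K_def using R by (intro sum_nonneg) auto
  have "\<bar>a n\<bar> * R ^ n \<le> K" for n
  proof (induction n rule: less_induct)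
    case (less n)
    show ?case
    proof (cases "n \<le> Suc N")
      case True
      then show ?thesis unfolding K_def using R
        by (intro member_le_sum) auto
    next
      case False
      then obtain m where n: "n = Suc (Suc m)" and mN: "m \<ge> N"
        by (metis Suc_le_D Suc_le_mono not_less_eq_eq)
      have P: "real (m + 1) * real (m + 2) > 0" by simp
      have PM: "M \<le> real (m + 1) * real (m + 2)"
      proof -
        have "M \<le> real m" using N mN by linarith
        also have "\<dots> \<le> real (m + 1) * real (m + 2)" by (simp add: algebra_simps)
        finally show ?thesis .
      qed
      have Rp: "R ^ 2 \<le> R ^ 4" "R ^ 3 \<le> R ^ 4"
        using R by (auto intro!: power_increasing)
      have b0: "\<bar>v0 * a m\<bar> * R ^ n \<le> \<bar>v0\<bar> * R ^ 4 * K"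
      proof -
        have "\<bar>v0 * a m\<bar> * R ^ n = (\<bar>v0\<bar> * R ^ 2) * (\<bar>a m\<bar> * R ^ m)"
          unfolding n by (simp add: abs_mult power2_eq_square)
        also have "\<dots> \<le> (\<bar>v0\<bar> * R ^ 4) * K"
          using less.IH[of m] n Rp R K0 by (intro mult_mono) (auto intro: mult_left_mono)
        finally show ?thesis .
      qed
      have b1: "\<bar>if 1 \<le> m then v1 * a (m - 1) else 0\<bar> * R ^ n \<le> \<bar>v1\<bar> * R ^ 4 * K"
      proof (cases "1 \<le> m")
        case True
        then obtain j where j: "m = Suc j" by (cases m) auto
        have "\<bar>v1 * a j\<bar> * R ^ n = (\<bar>v1\<bar> * R ^ 3) * (\<bar>a j\<bar> * R ^ j)"
          unfolding n j by (simp add: abs_mult power3_eq_cube)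
        also have "\<dots> \<le> (\<bar>v1\<bar> * R ^ 4) * K"
          using less.IH[of j] n j Rp R K0 by (intro mult_mono) (auto intro: mult_left_mono)
        finally show ?thesis using j by simp
      qed (use R K0 in auto)
      have b2: "\<bar>if 2 \<le> m then v2 * a (m - 2) else 0\<bar> * R ^ n \<le> \<bar>v2\<bar> * R ^ 4 * K"
      proof (cases "2 \<le> m")
        case True
        then obtain j where j: "m = Suc (Suc j)" by (metis Suc_le_D numeral_2_eq_2 Suc_le_mono)
        have "\<bar>v2 * a j\<bar> * R ^ n = (\<bar>v2\<bar> * R ^ 4) * (\<bar>a j\<bar> * R ^ j)"
          unfolding n j by (simp add: abs_mult power4_eq_xxxx)
        also have "\<dots> \<le> (\<bar>v2\<bar> * R ^ 4) * K"
          using less.IH[of j] n j Rp R K0 by (intro mult_mono) auto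
        finally show ?thesis using j by simp
      qed (use R K0 in auto)
      define s where "s = v0 * a m + (if 1 \<le> m then v1 * a (m - 1) else 0)
        + (if 2 \<le> m then v2 * a (m - 2) else 0)"
      have "\<bar>s\<bar> * R ^ n \<le> (\<bar>v0 * a m\<bar> + \<bar>if 1 \<le> m then v1 * a (m - 1) else 0\<bar>
          + \<bar>if 2 \<le> m then v2 * a (m - 2) else 0\<bar>) * R ^ n"
        unfolding s_def using R
        by (intro mult_right_mono order_trans[OF abs_triangle_ineq] add_right_mono) auto
      also have "\<dots> \<le> M * K"
        using b0 b1 b2 unfolding M_def by (simp add: algebra_simps)
      also have "\<dots> \<le> real (m + 1) * real (m + 2) * K"
        using PM K0 by (intro mult_right_mono)
      finally have s: "\<bar>s\<bar> * R ^ n \<le> real (m + 1) * real (m + 2) * K" .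
      have "a n = s / (real (m + 1) * real (m + 2))"
        unfolding n s_def a_def by simp
      then have "\<bar>a n\<bar> * R ^ n = (\<bar>s\<bar> * R ^ n) / (real (m + 1) * real (m + 2))"
        using P by (simp add: abs_divide abs_of_pos)
      also have "\<dots> \<le> K"
        using s P by (subst pos_divide_le_eq) (auto simp: mult.commute)
      finally show ?thesis .
    qed
  qed
  then show ?thesis unfolding a_def by blast
qed

text \<open>Abel's lemma at the radius \<open>\<bar>x\<bar> + 1\<close>, which is at least 1 and
  strictly larger than \<open>\<bar>x\<bar>\<close>.\<close>

lemma quadratic_coeff_summable:
  "summable (\<lambda>n. quadratic_coeff v0 v1 v2 A B n * x ^ n)"
proof -
  define r where "r = \<bar>x\<bar> + 1"
  obtain K where K: "\<And>n. \<bar>quadratic_coeff v0 v1 v2 A B n\<bar> * r ^ n \<le> K"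
    using quadratic_coeff_bounded[of r v0 v1 v2 A B] unfolding r_def by auto
  have "summable (\<lambda>n. norm (quadratic_coeff v0 v1 v2 A B n) * \<bar>x\<bar> ^ n)"
    by (rule Abel_lemma[where ?r0.0 = r and M = K]) (use K in \<open>auto simp: r_def\<close>)
  then have "summable (\<lambda>n. norm (quadratic_coeff v0 v1 v2 A B n * x ^ n))"
    by (simp add: abs_mult power_abs)
  then show ?thesis by (rule summable_norm_cancel)
qed

text \<open>Posing the equation on the whole line gives two-sided derivatives at \<open>-d\<close>
  and \<open>d\<close> and lets the initial data sit at any point. The derivative is carried as a
  function so that initial data and Wronskians can refer to it.\<close>

definition ode_sol :: "(real \<Rightarrow> real) \<Rightarrow> (real \<Rightarrow> real) \<Rightarrow> (real \<Rightarrow> real) \<Rightarrow> bool" where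
  "ode_sol V u u' \<longleftrightarrow> (\<forall>x. (u has_real_derivative u' x) (at x)) \<and>
     (\<forall>x. (u' has_real_derivative V x * u x) (at x))"

text \<open>The series converges everywhere, so it may be differentiated termwise twice, and the
  recurrence is the comparison of coefficients. A translation moves the base point from 0 to
  \<open>x0\<close>.\<close>

lemma ode_sol_quadratic_exists:
  fixes v0 v1 v2 A B x0 :: real
  shows "\<exists>u u'. ode_sol (\<lambda>x. v0 + v1 * (x - x0) + v2 * (x - x0)\<^sup>2) u u' \<and> u x0 = A \<and> u' x0 = B"
proof -
  define a where "a = quadratic_coeff v0 v1 v2 A B"
  define u where "u t = (\<Sum>n. a n * t ^ n)" for t :: real
  define u' where "u' t = (\<Sum>n. diffs a n * t ^ n)" for t :: real
  have sa: "summable (\<lambda>n. a n * t ^ n)" for t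
    unfolding a_def by (rule quadratic_coeff_summable)
  have sd: "summable (\<lambda>n. diffs a n * t ^ n)" for t
    by (rule termdiff_converges_all) (rule sa)
  have d1: "(u has_real_derivative u' t) (at t)" for t
    unfolding u_def u'_def by (rule termdiffs_strong_converges_everywhere) (rule sa)
  have d2: "(u' has_real_derivative (\<Sum>n. diffs (diffs a) n * t ^ n)) (at t)" for t
    unfolding u'_def by (rule termdiffs_strong_converges_everywhere) (rule sd)
  have eq: "(\<Sum>n. diffs (diffs a) n * t ^ n) = (v0 + v1 * t + v2 * t\<^sup>2) * u t" for t
  proof -
    have s0: "(\<lambda>n. a n * t ^ n) sums u t" unfolding u_def using sa by (rule summable_sums)
    \<comment> \<open>\<open>b\<close> and, below, \<open>e\<close> are the series of
      \<open>t * u\<close> and \<open>t^2 * u\<close>, aligned with the powers of \<open>t\<close>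
      by prepending one and two zero terms.\<close>
    define b where "b n = (if 1 \<le> n then a (n - 1) else 0) * t ^ n" for n
    have "(\<lambda>n. b (Suc n)) sums (t * u t)"
      using sums_mult[OF s0, of t] by (simp add: b_def mult_ac)
    then have s1: "b sums (t * u t)"
      using sums_Suc[of b] by (simp add: b_def)
    define e where "e n = (if 2 \<le> n then a (n - 2) else 0) * t ^ n" for n
    have "(\<lambda>n. e (Suc (Suc n))) sums (t\<^sup>2 * u t)"
      using sums_mult[OF s0, of "t\<^sup>2"] by (simp add: e_def mult_ac power2_eq_square)
    then have "(\<lambda>n. e (Suc n)) sums (t\<^sup>2 * u t)"
      using sums_Suc[of "\<lambda>n. e (Suc n)"] by (simp add: e_def)
    then have s2: "e sums (t\<^sup>2 * u t)"
      using sums_Suc[of e] by (simp add: e_def)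
    have "(\<lambda>n. v0 * (a n * t ^ n) + v1 * b n + v2 * e n) sums
        (v0 * u t + v1 * (t * u t) + v2 * (t\<^sup>2 * u t))"
      by (intro sums_add sums_mult s0 s1 s2)
    moreover have "v0 * (a n * t ^ n) + v1 * b n + v2 * e n = diffs (diffs a) n * t ^ n" for n
    proof -
      have P: "real (n + 1) * real (n + 2) \<noteq> 0" by simp
      have "diffs (diffs a) n = (real (n + 1) * real (n + 2)) * a (Suc (Suc n))"
        by (simp add: diffs_def algebra_simps)
      also have "\<dots> = v0 * a n + (if 1 \<le> n then v1 * a (n - 1) else 0)
          + (if 2 \<le> n then v2 * a (n - 2) else 0)"
        unfolding a_def quadratic_coeff.simps(3) using P
        by (metis (no_types, lifting) nonzero_mult_div_cancel_left times_divide_eq_right)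
      finally show ?thesis by (auto simp: b_def e_def algebra_simps)
    qed
    ultimately have "(\<lambda>n. diffs (diffs a) n * t ^ n) sums
        (v0 * u t + v1 * (t * u t) + v2 * (t\<^sup>2 * u t))" by simp
    then show ?thesis by (simp add: sums_iff algebra_simps)
  qed
  have shift: "((\<lambda>x. f (x - x0)) has_real_derivative D) (at x)"
    if "(f has_real_derivative D) (at (x - x0))" for f :: "real \<Rightarrow> real" and D x
    using iffD1[OF DERIV_shift[of f D x "- x0"]] that by simp
  have "ode_sol (\<lambda>x. v0 + v1 * (x - x0) + v2 * (x - x0)\<^sup>2) (\<lambda>x. u (x - x0)) (\<lambda>x. u' (x - x0))"
    unfolding ode_sol_def by (intro allI conjI shift d1 d2[unfolded eq])
  moreover have "u 0 = A" "u' 0 = B"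
    unfolding u_def u'_def by (simp_all add: powser_zero a_def diffs_def)
  ultimately show ?thesis by (intro exI[of _ "\<lambda>x. u (x - x0)"] exI[of _ "\<lambda>x. u' (x - x0)"]) simp
qed

lemma ode_sol_deriv:
  assumes "ode_sol V u u'"
  shows "(u has_real_derivative u' x) (at x within S)"
    and "(u' has_real_derivative V x * u x) (at x within S)"
  using assms unfolding ode_sol_def by (auto intro: has_field_derivative_at_within)

lemma ode_sol_continuous:
  assumes "ode_sol V u u'"
  shows "continuous_on S u" "continuous_on S u'"
  by (rule DERIV_continuous_on, rule ode_sol_deriv[OF assms])+

section \<open>Gronwall estimate, uniqueness and symmetry\<close>

lemma linear_ode_gronwall:
  fixes u u' V f :: "real \<Rightarrow> real"
  assumes u: "\<And>x. x \<in> {a..b} \<Longrightarrow> (u has_real_derivative u' x) (at x)"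
    and u': "\<And>x. x \<in> {a..b} \<Longrightarrow> (u' has_real_derivative V x * u x + f x) (at x)"
    and V: "\<And>x. x \<in> {a..b} \<Longrightarrow> \<bar>V x\<bar> \<le> M"
    and f: "\<And>x. x \<in> {a..b} \<Longrightarrow> \<bar>f x\<bar> \<le> F"
    and init: "u a = 0" "u' a = 0"
    and x: "x \<in> {a..b}"
  shows "(u x)\<^sup>2 + (u' x)\<^sup>2 \<le> (b - a) * exp ((M + 2) * (b - a)) * F\<^sup>2"
proof -
  \<comment> \<open>Of the rate \<open>M + 2\<close>, the part \<open>1 + M\<close> absorbs
    \<open>2 u u' (1 + V)\<close> and the remaining 1 absorbs the \<open>u'^2\<close> from
    \<open>2 u' f \<le> u'^2 + f^2\<close>. What is left is at most \<open>F^2\<close>, the slope of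
    the subtracted linear term.\<close>
  define G where "G t = ((u t)\<^sup>2 + (u' t)\<^sup>2) * exp (- (M + 2) * (t - a)) - F\<^sup>2 * (t - a)" for t
  have M0: "M \<ge> 0" using V[OF x] by linarith
  have "G x \<le> G a"
  proof (rule DERIV_nonpos_imp_nonincreasing[where f = G])
    show "a \<le> x" using x by simp
    fix t assume "a \<le> t" "t \<le> x"
    then have t: "t \<in> {a..b}" using x by simp
    define E where "E = exp (- (M + 2) * (t - a))"
    define y where "y = (2 * u t * u' t + 2 * u' t * (V t * u t + f t)
        - (M + 2) * ((u t)\<^sup>2 + (u' t)\<^sup>2)) * E - F\<^sup>2"
    have d: "(G has_real_derivative y) (at t)"
      unfolding G_def y_def E_def
      by (auto intro!: derivative_eq_intros u[OF t] u'[OF t] simp: algebra_simps power2_eq_square)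
    have E: "0 < E" "E \<le> 1"
      unfolding E_def using t M0 by (auto simp: mult_nonpos_nonneg)
    have "2 * u t * u' t * (1 + V t) \<le> (1 + M) * ((u t)\<^sup>2 + (u' t)\<^sup>2)"
    proof -
      have "2 * u t * u' t * (1 + V t) \<le> \<bar>2 * u t * u' t\<bar> * \<bar>1 + V t\<bar>"
        by (metis abs_ge_self abs_mult)
      also have "\<dots> \<le> ((u t)\<^sup>2 + (u' t)\<^sup>2) * (1 + M)"
        using V[OF t] sum_squares_bound[of "u t" "u' t"] sum_squares_bound[of "u t" "- u' t"]
        by (intro mult_mono) (auto simp: abs_le_iff)
      finally show ?thesis by (simp add: mult.commute)
    qed
    moreover have "2 * u' t * f t \<le> (u' t)\<^sup>2 + F\<^sup>2"
    proof -
      have "(f t)\<^sup>2 \<le> F\<^sup>2" using f[OF t] by (simp add: abs_le_square_iff[symmetric])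
      then show ?thesis using sum_squares_bound[of "u' t" "f t"] by linarith
    qed
    ultimately have "2 * u t * u' t + 2 * u' t * (V t * u t + f t)
        - (M + 2) * ((u t)\<^sup>2 + (u' t)\<^sup>2) \<le> F\<^sup>2"
      by (simp add: algebra_simps) (use zero_le_power2[of "u t"] in linarith)
    then have "(2 * u t * u' t + 2 * u' t * (V t * u t + f t)
        - (M + 2) * ((u t)\<^sup>2 + (u' t)\<^sup>2)) * E \<le> F\<^sup>2 * E"
      using E by (intro mult_right_mono) auto
    also have "\<dots> \<le> F\<^sup>2" using E by (simp add: mult_left_le)
    finally have "y \<le> 0" unfolding y_def by simp
    with d show "\<exists>y. (G has_real_derivative y) (at t) \<and> y \<le> 0" by blast
  qed
  then have *: "((u x)\<^sup>2 + (u' x)\<^sup>2) * exp (- (M + 2) * (x - a)) \<le> F\<^sup>2 * (x - a)"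
    by (simp add: G_def init)
  have "(u x)\<^sup>2 + (u' x)\<^sup>2
      = ((u x)\<^sup>2 + (u' x)\<^sup>2) * exp (- (M + 2) * (x - a)) * exp ((M + 2) * (x - a))"
    by (simp add: mult.assoc exp_add[symmetric] algebra_simps)
  also have "\<dots> \<le> F\<^sup>2 * (x - a) * exp ((M + 2) * (x - a))"
    using * by (intro mult_right_mono) auto
  also have "\<dots> \<le> F\<^sup>2 * (b - a) * exp ((M + 2) * (b - a))"
    using x M0 by (intro mult_mono mult_left_mono) auto
  finally show ?thesis by (simp add: mult_ac)
qed

text \<open>The difference \<open>u - v\<close> solves the equation with potential \<open>V\<close>
  and forcing \<open>(V - W) v\<close>, starting from zero data. The constant \<open>C\<close> does
  not involve \<open>e\<close>, so the dependence on the potential is Lipschitz.\<close>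

lemma ode_sol_perturbation:
  assumes u: "ode_sol V u u'" and v: "ode_sol W v v'"
    and V: "\<And>x. x \<in> {a..b} \<Longrightarrow> \<bar>V x\<bar> \<le> M"
    and VW: "\<And>x. x \<in> {a..b} \<Longrightarrow> \<bar>V x - W x\<bar> \<le> e"
    and S: "\<And>x. x \<in> {a..b} \<Longrightarrow> \<bar>v x\<bar> \<le> S"
    and init: "u a = v a" "u' a = v' a"
    and x: "x \<in> {a..b}"
  defines "C \<equiv> sqrt ((b - a) * exp ((M + 2) * (b - a))) * S"
  shows "\<bar>u x - v x\<bar> \<le> C * e" "\<bar>u' x - v' x\<bar> \<le> C * e"
proof -
  have S0: "S \<ge> 0" using S[OF x] by linarith
  have e0: "e \<ge> 0" using VW[OF x] by linarith
  have Q: "(u x - v x)\<^sup>2 + (u' x - v' x)\<^sup>2 \<le> (b - a) * exp ((M + 2) * (b - a)) * (e * S)\<^sup>2"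
  proof (rule linear_ode_gronwall[where V = V and f = "\<lambda>x. (V x - W x) * v x"
        and u = "\<lambda>x. u x - v x" and u' = "\<lambda>x. u' x - v' x"])
    fix t assume t: "t \<in> {a..b}"
    show "((\<lambda>x. u x - v x) has_real_derivative u' t - v' t) (at t)"
      by (intro DERIV_diff ode_sol_deriv[OF u] ode_sol_deriv[OF v])
    have "((\<lambda>x. u' x - v' x) has_real_derivative V t * u t - W t * v t) (at t)"
      by (intro DERIV_diff ode_sol_deriv[OF u] ode_sol_deriv[OF v])
    then show "((\<lambda>x. u' x - v' x) has_real_derivative V t * (u t - v t) + (V t - W t) * v t) (at t)"
      by (simp add: algebra_simps)
    show "\<bar>V t\<bar> \<le> M" using V[OF t] .
    show "\<bar>(V t - W t) * v t\<bar> \<le> e * S"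
      unfolding abs_mult using VW[OF t] S[OF t] e0 by (intro mult_mono) auto
  qed (use init x in auto)
  have ba: "b - a \<ge> 0" using x by simp
  have "(b - a) * exp ((M + 2) * (b - a)) * (e * S)\<^sup>2 = (C * e)\<^sup>2"
    unfolding C_def using ba by (simp add: power_mult_distrib mult_ac)
  then have "(u x - v x)\<^sup>2 \<le> (C * e)\<^sup>2" "(u' x - v' x)\<^sup>2 \<le> (C * e)\<^sup>2"
    using Q zero_le_power2[of "u x - v x"] zero_le_power2[of "u' x - v' x"] by linarith+
  moreover have "C * e \<ge> 0" unfolding C_def using S0 e0 ba by simp
  ultimately show "\<bar>u x - v x\<bar> \<le> C * e" "\<bar>u' x - v' x\<bar> \<le> C * e"
    using abs_le_square_iff[of "u x - v x" "C * e"] abs_le_square_iff[of "u' x - v' x" "C * e"]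
    by simp_all
qed

lemma continuous_bounded_on_interval:
  fixes f :: "real \<Rightarrow> real"
  assumes "continuous_on {a..b} f"
  obtains B where "B > 0" "\<And>x. x \<in> {a..b} \<Longrightarrow> \<bar>f x\<bar> \<le> B"
proof -
  have "compact (f ` {a..b})" using assms compact_continuous_image compact_Icc by blast
  then have "bounded (f ` {a..b})" by (rule compact_imp_bounded)
  then obtain B where "B > 0" "\<forall>y \<in> f ` {a..b}. norm y \<le> B" by (auto simp: bounded_pos)
  then show ?thesis by (intro that[of B]) auto
qed

text \<open>The perturbation bound with \<open>e = 0\<close>.\<close>

lemma ode_sol_unique:
  assumes u: "ode_sol V u u'" and v: "ode_sol V v v'" and V: "continuous_on UNIV V"
    and init: "u a = v a" "u' a = v' a" and x: "a \<le> x"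
  shows "u x = v x" "u' x = v' x"
proof -
  obtain M where M: "\<And>t. t \<in> {a..x} \<Longrightarrow> \<bar>V t\<bar> \<le> M"
    by (rule continuous_bounded_on_interval[OF continuous_on_subset[OF V subset_UNIV]]) blast
  obtain S where S: "\<And>t. t \<in> {a..x} \<Longrightarrow> \<bar>v t\<bar> \<le> S"
    by (rule continuous_bounded_on_interval[OF ode_sol_continuous(1)[OF v]]) blast
  show "u x = v x" "u' x = v' x"
    using ode_sol_perturbation[OF u v M _ S init, of x 0 x] x by auto
qed

lemma ode_sol_reflect:
  assumes u: "ode_sol V u u'" and V: "\<And>x. V (- x) = V x"
  shows "ode_sol V (\<lambda>x. u (- x)) (\<lambda>x. - u' (- x))"
proof -
  have "((\<lambda>x. u (- x)) has_real_derivative - u' (- x)) (at x)" for x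
    using DERIV_mirror[of u "u' (-x)" x] ode_sol_deriv(1)[OF u, of "- x" UNIV] by simp
  moreover have "((\<lambda>x. - u' (- x)) has_real_derivative V x * u (- x)) (at x)" for x
  proof -
    have "((\<lambda>x. u' (- x)) has_real_derivative - (V x * u (- x))) (at x)"
      using DERIV_mirror[of u' "V x * u (-x)" x] ode_sol_deriv(2)[OF u, of "- x" UNIV] V
      by simp
    from DERIV_minus[OF this] show ?thesis by simp
  qed
  ultimately show ?thesis unfolding ode_sol_def by blast
qed

lemma ode_sol_scale:
  assumes u: "ode_sol V u u'"
  shows "ode_sol V (\<lambda>x. k * u x) (\<lambda>x. k * u' x)"
  unfolding ode_sol_def
proof (intro conjI allI)
  fix x
  show "((\<lambda>x. k * u x) has_real_derivative k * u' x) (at x)"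
    by (intro DERIV_cmult ode_sol_deriv[OF u])
  have "((\<lambda>x. k * u' x) has_real_derivative k * (V x * u x)) (at x)"
    by (intro DERIV_cmult ode_sol_deriv[OF u])
  then show "((\<lambda>x. k * u' x) has_real_derivative V x * (k * u x)) (at x)"
    by (simp add: mult.left_commute)
qed

lemma ode_sol_even:
  assumes u: "ode_sol V u u'" and V: "continuous_on UNIV V" "\<And>x. V (- x) = V x" and 0: "u' 0 = 0"
  shows "u (- x) = u x" "u' (- x) = - u' x"
proof -
  \<comment> \<open>Uniqueness runs to the right of the base point, so \<open>u\<close> is compared
    with its reflection on \<open>t \<ge> 0\<close>; both signs of \<open>x\<close> follow from
    that.\<close>
  have "u (- t) = u t \<and> u' (- t) = - u' t" if "t \<ge> 0" for t
    using ode_sol_unique[OF ode_sol_reflect[OF u V(2)] u V(1), of 0 t] that 0 by auto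
  from this[of x] this[of "-x"] show "u (- x) = u x" "u' (- x) = - u' x"
    by (cases "x \<ge> 0"; simp)+
qed

lemma ode_sol_odd:
  assumes u: "ode_sol V u u'" and V: "continuous_on UNIV V" "\<And>x. V (- x) = V x" and 0: "u 0 = 0"
  shows "u (- x) = - u x" "u' (- x) = u' x"
proof -
  have "u (- t) = - u t \<and> u' (- t) = u' t" if "t \<ge> 0" for t
    using ode_sol_unique[OF ode_sol_scale[OF ode_sol_reflect[OF u V(2)], of "-1"] u V(1), of 0 t]
      that 0 by auto
  from this[of x] this[of "-x"] show "u (- x) = - u x" "u' (- x) = u' x"
    by (cases "x \<ge> 0"; simp)+
qed

section \<open>Wronskians and Sturm comparison\<close>

text \<open>\<open>V\<close> and \<open>W\<close> are numbers, the values of the potentials at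
  \<open>x\<close>. Working within a set \<open>S\<close> covers both one-sided solutions on
  \<open>[-d,d]\<close> and global ones.\<close>

lemma wronskian_deriv:
  fixes u v :: "real \<Rightarrow> real"
  assumes "(u has_real_derivative u' x) (at x within S)"
    and "(u' has_real_derivative V * u x) (at x within S)"
    and "(v has_real_derivative v' x) (at x within S)"
    and "(v' has_real_derivative W * v x) (at x within S)"
  shows "((\<lambda>x. u x * v' x - v x * u' x) has_real_derivative (W - V) * u x * v x) (at x within S)"
  by (auto intro!: derivative_eq_intros assms simp: algebra_simps)

text \<open>While \<open>v\<close> is nonnegative the Wronskian cannot decrease, hence neither can
  \<open>v / u\<close>. This quotient starts positive, so \<open>v\<close> has no first zero, and
  the inequality of logarithmic slopes persists.\<close>

lemma sturm_comparison:
  assumes u: "ode_sol V u u'" and v: "ode_sol W v v'"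
    and le: "\<And>x. x \<in> {0..d} \<Longrightarrow> V x \<le> W x"
    and upos: "\<And>x. x \<in> {0..d} \<Longrightarrow> u x > 0"
    and init: "v 0 > 0" "u 0 * v' 0 \<ge> v 0 * u' 0"
    and x: "x \<in> {0..d}"
  shows "v x > 0" "u x * v' x \<ge> v x * u' x"
proof -
  define D where "D x = u x * v' x - v x * u' x" for x
  have dD: "(D has_real_derivative (W x - V x) * u x * v x) (at x)" for x
    unfolding D_def by (intro wronskian_deriv ode_sol_deriv[OF u] ode_sol_deriv[OF v])
  have mono: "D y \<ge> 0" if "y \<in> {0..d}" and nn: "\<And>t. t \<in> {0..y} \<Longrightarrow> v t \<ge> 0" for y
  proof -
    have "D 0 \<le> D y"
    proof (rule DERIV_nonneg_imp_nondecreasing[where f = D])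
      fix t assume t: "0 \<le> t" "t \<le> y"
      then have "(W t - V t) * u t * v t \<ge> 0"
        using le[of t] upos[of t] nn[of t] that(1) by (intro mult_nonneg_nonneg) auto
      with dD show "\<exists>y. (D has_real_derivative y) (at t) \<and> 0 \<le> y" by blast
    qed (use that in auto)
    then show ?thesis using init(2) unfolding D_def by linarith
  qed
  have vpos: "v y > 0" if y: "y \<in> {0..d}" for y
  proof (rule ccontr)
    assume neg: "\<not> v y > 0"
    \<comment> \<open>By compactness there is a first point \<open>z\<close> at which
      \<open>v\<close> is not positive; the intermediate value theorem shows that \<open>v\<close>
      is still nonnegative there, so monotonicity of the Wronskian holds up to and including
      \<open>z\<close>.\<close>
    define Z where "Z = {0..y} \<inter> v -` {..0}"
    have "closed Z"
      unfolding Z_def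
      by (intro continuous_closed_preimage ode_sol_continuous[OF v]) auto
    moreover have Zb: "Z \<subseteq> {0..y}" unfolding Z_def by auto
    ultimately have "compact Z" by (meson bounded_closed_interval bounded_subset compact_eq_bounded_closed)
    moreover have "y \<in> Z" using y neg unfolding Z_def by auto
    ultimately obtain z where z: "z \<in> Z" "\<And>t. t \<in> Z \<Longrightarrow> z \<le> t"
      using compact_attains_inf[of Z] by blast
    have zd: "z \<in> {0..d}" "v z \<le> 0" using z(1) y unfolding Z_def by auto
    have less: "v t > 0" if "0 \<le> t" "t < z" for t
      using z(2)[of t] that z(1) unfolding Z_def by force
    have z0: "z > 0" using zd init(1) by (cases "z = 0") auto
    have cont: "continuous_on {0..z} v" by (rule ode_sol_continuous[OF v])
    have vz: "v z \<ge> 0"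
    proof (rule ccontr)
      assume "\<not> v z \<ge> 0"
      then have "v z < 0" by simp
      then obtain t where "0 \<le> t" "t \<le> z" "v t = v z / 2"
        using IVT2'[of v z "v z / 2" 0] init(1) z0 cont by auto
      then show False using less[of t] \<open>v z < 0\<close> by (cases "t = z") auto
    qed
    have "v 0 / u 0 \<le> v z / u z"
    proof (rule DERIV_nonneg_imp_nondecreasing[where f = "\<lambda>x. v x / u x"])
      fix t assume t: "0 \<le> t" "t \<le> z"
      then have td: "t \<in> {0..d}" using zd by auto
      then have ut: "u t > 0" by (rule upos)
      have "((\<lambda>x. v x / u x) has_real_derivative D t / (u t)\<^sup>2) (at t)"
        unfolding D_def using ut
        by (auto intro!: derivative_eq_intros ode_sol_deriv[OF u] ode_sol_deriv[OF v]
            simp: power2_eq_square mult.commute)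
      moreover have "D t \<ge> 0" using mono[OF td] less vz t by (metis atLeastAtMost_iff dual_order.trans less_eq_real_def)
      ultimately show "\<exists>y. ((\<lambda>x. v x / u x) has_real_derivative y) (at t) \<and> 0 \<le> y"
        using ut by (intro exI[of _ "D t / (u t)\<^sup>2"]) auto
    qed (use z0 in auto)
    moreover have "v 0 / u 0 > 0" using init(1) upos[of 0] zd by auto
    moreover have "v z / u z \<le> 0" using zd upos[of z] by (simp add: divide_nonpos_pos)
    ultimately show False by linarith
  qed
  show "v x > 0" using vpos[OF x] .
  show "u x * v' x \<ge> v x * u' x"
  proof -
    have "v t \<ge> 0" if "t \<in> {0..x}" for t using vpos[of t] that x by simp
    from mono[OF x this] show ?thesis unfolding D_def by simp
  qed
qed

subsection \<open>Positive solutions and the critical field\<close>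

definition pot :: "real \<Rightarrow> real \<Rightarrow> real \<Rightarrow> real \<Rightarrow> real" where
  "pot \<kappa> h c x = \<kappa>\<^sup>2 * (h\<^sup>2 * (x + c)\<^sup>2 - 1)"

section \<open>Uniqueness of the field and of the positive solution\<close>

text \<open>The Wronskian of two positive solutions vanishes at both ends, while its derivative is
  \<open>(h2^2 - h1^2)\<close> times a nonnegative function. This forces equal fields; the Wronskian
  is then identically zero and the quotient of the solutions is constant.\<close>

lemma positive_solution_unique:
  assumes d: "d > 0" and \<kappa>: "\<kappa> > 0" and h: "h1 > 0" "h2 > 0"
    and s1: "positive_solution \<kappa> d h1 c \<psi>1" and s2: "positive_solution \<kappa> d h2 c \<psi>2"
  shows "h1 = h2" and "\<And>x. x \<in> {-d..d} \<Longrightarrow> \<psi>1 x = \<psi>2 x"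
proof -
  let ?S = "{-d..d}"
  obtain \<psi>1' where d1: "\<And>x. x \<in> ?S \<Longrightarrow> (\<psi>1 has_real_derivative \<psi>1' x) (at x within ?S)"
    "\<And>x. x \<in> ?S \<Longrightarrow> (\<psi>1' has_real_derivative pot \<kappa> h1 c x * \<psi>1 x) (at x within ?S)"
    and e1: "\<psi>1 (-d) = 1" "\<psi>1' (-d) = 0" "\<psi>1' d = 0" and p1: "\<And>x. x \<in> ?S \<Longrightarrow> \<psi>1 x > 0"
    using s1 unfolding positive_solution_def pot_def by blast
  obtain \<psi>2' where d2: "\<And>x. x \<in> ?S \<Longrightarrow> (\<psi>2 has_real_derivative \<psi>2' x) (at x within ?S)"
    "\<And>x. x \<in> ?S \<Longrightarrow> (\<psi>2' has_real_derivative pot \<kappa> h2 c x * \<psi>2 x) (at x within ?S)"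
    and e2: "\<psi>2 (-d) = 1" "\<psi>2' (-d) = 0" "\<psi>2' d = 0" and p2: "\<And>x. x \<in> ?S \<Longrightarrow> \<psi>2 x > 0"
    using s2 unfolding positive_solution_def pot_def by blast
  define D where "D x = \<psi>1 x * \<psi>2' x - \<psi>2 x * \<psi>1' x" for x
  have dD: "(D has_real_derivative (pot \<kappa> h2 c x - pot \<kappa> h1 c x) * \<psi>1 x * \<psi>2 x) (at x within ?S)"
    if "x \<in> ?S" for x
    unfolding D_def by (intro wronskian_deriv d1 d2 that)
  have D_bd: "D (-d) = 0" "D d = 0" using e1 e2 by (simp_all add: D_def)
  have c1: "continuous_on ?S \<psi>1" and c2: "continuous_on ?S \<psi>2"
    by (rule DERIV_continuous_on[OF d1(1)] DERIV_continuous_on[OF d2(1)]; assumption)+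
  show hh: "h1 = h2"
  proof (rule ccontr)
    assume "h1 \<noteq> h2"
    then have ne: "h2\<^sup>2 - h1\<^sup>2 \<noteq> 0" using h by (simp add: power2_eq_iff)
    have "((\<lambda>x. (pot \<kappa> h2 c x - pot \<kappa> h1 c x) * \<psi>1 x * \<psi>2 x) has_integral (D d - D (-d))) ?S"
      using dD d by (intro fundamental_theorem_of_calculus)
        (auto simp: has_real_derivative_iff_has_vector_derivative)
    from has_integral_mult_right[OF this, of "inverse (\<kappa>\<^sup>2 * (h2\<^sup>2 - h1\<^sup>2))"]
    have "((\<lambda>x. inverse (\<kappa>\<^sup>2 * (h2\<^sup>2 - h1\<^sup>2)) * ((pot \<kappa> h2 c x - pot \<kappa> h1 c x) * \<psi>1 x * \<psi>2 x))
        has_integral 0) ?S"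
      by (simp only: D_bd diff_self mult_zero_right)
    moreover have "inverse (\<kappa>\<^sup>2 * (h2\<^sup>2 - h1\<^sup>2)) * ((pot \<kappa> h2 c x - pot \<kappa> h1 c x) * \<psi>1 x * \<psi>2 x)
        = (x + c)\<^sup>2 * \<psi>1 x * \<psi>2 x" for x
    proof -
      have "pot \<kappa> h2 c x - pot \<kappa> h1 c x = (\<kappa>\<^sup>2 * (h2\<^sup>2 - h1\<^sup>2)) * (x + c)\<^sup>2"
        by (simp add: pot_def algebra_simps)
      moreover define k where "k = \<kappa>\<^sup>2 * (h2\<^sup>2 - h1\<^sup>2)"
      ultimately have "pot \<kappa> h2 c x - pot \<kappa> h1 c x = k * (x + c)\<^sup>2" by simp
      moreover have "k \<noteq> 0" using \<kappa> ne by (simp add: k_def)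
      ultimately show ?thesis unfolding k_def[symmetric] by simp
    qed
    ultimately have int0: "((\<lambda>x. (x + c)\<^sup>2 * \<psi>1 x * \<psi>2 x) has_integral 0) (cbox (-d) d)"
      by (simp only: cbox_interval)
    \<comment> \<open>A continuous nonnegative integrand with zero integral vanishes everywhere, in
      particular at \<open>d\<close> and \<open>-d\<close>; but \<open>x + c\<close> has only one
      zero.\<close>
    have "(x + c)\<^sup>2 * \<psi>1 x * \<psi>2 x = 0" if "x \<in> cbox (-d) d" for x
    proof (rule has_integral_0_cbox_imp_0[OF _ _ int0 _ that])
      show "continuous_on (cbox (-d) d) (\<lambda>x. (x + c)\<^sup>2 * \<psi>1 x * \<psi>2 x)"
        using c1 c2 by (auto intro!: continuous_intros)
      show "0 \<le> (x + c)\<^sup>2 * \<psi>1 x * \<psi>2 x" if "x \<in> box (-d) d" for x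
        using p1[of x] p2[of x] that by (auto simp: less_imp_le)
      show "box (-d) d \<noteq> {}" using d by simp
    qed
    from this[of d] this[of "-d"] p1[of d] p2[of d] p1[of "-d"] p2[of "-d"] d
    have "d + c = 0" "- d + c = 0" by auto
    then show False using d by linarith
  qed
  have D0: "D x = 0" if "x \<in> ?S" for x
  proof -
    have "\<exists>k. \<forall>x\<in>?S. D x = k"
      using dD unfolding hh by (intro has_field_derivative_zero_constant) auto
    then show ?thesis using D_bd that by force
  qed
  have "\<exists>k. \<forall>x\<in>?S. \<psi>2 x / \<psi>1 x = k"
  proof (rule has_field_derivative_zero_constant)
    fix x assume x: "x \<in> ?S"
    have "((\<lambda>x. \<psi>2 x / \<psi>1 x) has_real_derivative D x / (\<psi>1 x)\<^sup>2) (at x within ?S)"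
      unfolding D_def using p1[OF x]
      by (auto intro!: derivative_eq_intros d1 d2 x simp: power2_eq_square mult.commute)
    then show "((\<lambda>x. \<psi>2 x / \<psi>1 x) has_real_derivative 0) (at x within ?S)" using D0[OF x] by simp
  qed auto
  then obtain k where k: "\<And>x. x \<in> ?S \<Longrightarrow> \<psi>2 x / \<psi>1 x = k" by blast
  have "k = 1" using k[of "-d"] e1 e2 d by simp
  then show "\<psi>1 x = \<psi>2 x" if "x \<in> ?S" for x using k[OF that] p1[OF that] by simp
qed

text \<open>Uniqueness resolves both definite descriptions, so exhibiting any positive solution
  identifies the field and the profile.\<close>

lemma crit_h_psi0_eq:
  assumes d: "d > 0" and \<kappa>: "\<kappa> > 0" and h: "h > 0" and s: "positive_solution \<kappa> d h c \<psi>"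
  shows "crit_h \<kappa> d c = h" and "\<And>x. x \<in> {-d..d} \<Longrightarrow> psi0 \<kappa> d c x = \<psi> x"
proof -
  show ch: "crit_h \<kappa> d c = h"
    unfolding crit_h_def
  proof (rule the_equality)
    show "h > 0 \<and> (\<exists>\<psi>. positive_solution \<kappa> d h c \<psi>)" using h s by blast
    fix h' assume "h' > 0 \<and> (\<exists>\<psi>. positive_solution \<kappa> d h' c \<psi>)"
    then show "h' = h" using positive_solution_unique(1)[OF d \<kappa> _ h _ s] by blast
  qed
  \<comment> \<open>Restriction supplies the extensionality demanded by \<open>psi0\<close>;
    derivatives within \<open>[-d,d]\<close> see only values on that interval.\<close>
  define \<phi> where "\<phi> = restrict \<psi> {-d..d}"
  have \<phi>: "positive_solution \<kappa> d h c \<phi>"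
  proof -
    obtain \<psi>' where p: "\<forall>x\<in>{-d..d}. (\<psi> has_real_derivative \<psi>' x) (at x within {-d..d})"
      "\<forall>x\<in>{-d..d}. (\<psi>' has_real_derivative \<kappa>\<^sup>2 * (h\<^sup>2 * (x + c)\<^sup>2 - 1) * \<psi> x) (at x within {-d..d})"
      "\<psi> (-d) = 1" "\<psi>' (-d) = 0" "\<psi>' d = 0" "\<forall>x\<in>{-d..d}. \<psi> x > 0"
      using s unfolding positive_solution_def by blast
    have "(\<phi> has_real_derivative \<psi>' x) (at x within {-d..d})" if "x \<in> {-d..d}" for x
      using p(1)[rule_format, OF that] unfolding has_field_derivative_def
      by (rule has_derivative_transform[OF that, rotated]) (simp add: \<phi>_def)
    then show ?thesis
      unfolding positive_solution_def using p d
      by (intro conjI exI[of _ \<psi>']) (auto simp: \<phi>_def)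
  qed
  have "psi0 \<kappa> d c = \<phi>"
    unfolding psi0_def ch
  proof (rule the_equality)
    show "positive_solution \<kappa> d h c \<phi> \<and> \<phi> \<in> extensional {-d..d}"
      using \<phi> by (simp add: \<phi>_def)
    fix \<phi>' assume \<phi>': "positive_solution \<kappa> d h c \<phi>' \<and> \<phi>' \<in> extensional {-d..d}"
    show "\<phi>' = \<phi>"
      by (rule extensionalityI[of _ "{-d..d}"])
        (use \<phi>' positive_solution_unique(2)[OF d \<kappa> h h _ \<phi>] in \<open>auto simp: \<phi>_def\<close>)
  qed
  then show "psi0 \<kappa> d c x = \<psi> x" if "x \<in> {-d..d}" for x using that by (simp add: \<phi>_def)
qed

lemma positive_solutionI:
  assumes "ode_sol (pot \<kappa> h c) u u'" "u (-d) = 1" "u' (-d) = 0" "u' d = 0"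
    and "\<And>x. x \<in> {-d..d} \<Longrightarrow> u x > 0"
  shows "positive_solution \<kappa> d h c u"
  unfolding positive_solution_def
proof (intro conjI exI[of _ u'] ballI)
  fix x
  show "(u has_real_derivative u' x) (at x within {-d..d})"
    by (rule ode_sol_deriv[OF assms(1)])
  show "(u' has_real_derivative \<kappa>\<^sup>2 * (h\<^sup>2 * (x + c)\<^sup>2 - 1) * u x) (at x within {-d..d})"
    using ode_sol_deriv(2)[OF assms(1)] unfolding pot_def .
qed (use assms in blast)+

section \<open>Shooting and the ground state at \<open>c = 0\<close>\<close>

lemma ode_sol_pot_exists:
  "\<exists>u u'. ode_sol (pot \<kappa> h c) u u' \<and> u a = A \<and> u' a = B"
proof -
  have "pot \<kappa> h c = (\<lambda>x. \<kappa>\<^sup>2 * (h\<^sup>2 * (a + c)\<^sup>2 - 1) + 2 * \<kappa>\<^sup>2 * h\<^sup>2 * (a + c) * (x - a)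
      + \<kappa>\<^sup>2 * h\<^sup>2 * (x - a)\<^sup>2)"
    by (rule ext) (simp add: pot_def algebra_simps power2_eq_square)
  then show ?thesis by (simp only: ode_sol_quadratic_exists)
qed

lemma continuous_on_pot: "continuous_on S (pot \<kappa> h c)"
  unfolding pot_def by (intro continuous_intros)

lemma pot_even: "pot \<kappa> h 0 (- x) = pot \<kappa> h 0 x"
  by (simp add: pot_def)

text \<open>The potential is affine in \<open>h^2\<close>, so the field enters as
  \<open>sqrt t\<close> with \<open>t = h^2\<close> as the parameter; this yields Lipschitz bounds
  in \<open>t\<close>.\<close>

lemma pot_sqrt_bounds:
  assumes t: "0 \<le> t" "t \<le> T" and x: "\<bar>x + c\<bar> \<le> R"
  shows "\<bar>pot \<kappa> (sqrt t) c x\<bar> \<le> \<kappa>\<^sup>2 * (T * R\<^sup>2 + 1)"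
    and "0 \<le> s \<Longrightarrow> \<bar>pot \<kappa> (sqrt t) c x - pot \<kappa> (sqrt s) c x\<bar> \<le> \<kappa>\<^sup>2 * R\<^sup>2 * \<bar>t - s\<bar>"
proof -
  have x2: "(x + c)\<^sup>2 \<le> R\<^sup>2" using power_mono[OF x, of 2] by simp
  have "t * (x + c)\<^sup>2 \<le> T * R\<^sup>2" using t x2 by (intro mult_mono) auto
  moreover have "0 \<le> t * (x + c)\<^sup>2" using t by simp
  ultimately have "\<bar>t * (x + c)\<^sup>2 - 1\<bar> \<le> T * R\<^sup>2 + 1" by linarith
  then show "\<bar>pot \<kappa> (sqrt t) c x\<bar> \<le> \<kappa>\<^sup>2 * (T * R\<^sup>2 + 1)"
    using t by (simp add: pot_def abs_mult mult_left_mono)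
  assume "0 \<le> s"
  then have "pot \<kappa> (sqrt t) c x - pot \<kappa> (sqrt s) c x = \<kappa>\<^sup>2 * (x + c)\<^sup>2 * (t - s)"
    using t by (simp add: pot_def algebra_simps)
  then show "\<bar>pot \<kappa> (sqrt t) c x - pot \<kappa> (sqrt s) c x\<bar> \<le> \<kappa>\<^sup>2 * R\<^sup>2 * \<bar>t - s\<bar>"
    using x2 by (simp add: abs_mult mult_left_mono mult_right_mono)
qed

text \<open>Prepares the intermediate value theorem for the shooting slope. At each \<open>s\<close>
  the solution for \<open>s\<close> is the fixed reference, so its bound \<open>S\<close> may depend
  on \<open>s\<close>.\<close>

lemma shooting_continuous:
  assumes E: "\<And>h. ode_sol (pot \<kappa> h c) (E h) (E' h)" "\<And>h. E h a = A" "\<And>h. E' h a = B"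
    and ab: "a \<le> b"
  shows "continuous_on {0..T} (\<lambda>t. E' (sqrt t) b)"
  unfolding continuous_on_def
proof
  fix s assume s: "s \<in> {0..T}"
  obtain S where S: "\<And>x. x \<in> {a..b} \<Longrightarrow> \<bar>E (sqrt s) x\<bar> \<le> S"
    by (rule continuous_bounded_on_interval[OF ode_sol_continuous(1)[OF E(1)]]) blast
  define R where "R = \<bar>a\<bar> + \<bar>b\<bar> + \<bar>c\<bar>"
  define M where "M = \<kappa>\<^sup>2 * (T * R\<^sup>2 + 1)"
  define C where "C = sqrt ((b - a) * exp ((M + 2) * (b - a))) * S"
  have bb: "b \<in> {a..b}" using ab by simp
  have "norm (E' (sqrt t) b - E' (sqrt s) b) \<le> C * (\<kappa>\<^sup>2 * R\<^sup>2 * \<bar>t - s\<bar>)" if t: "t \<in> {0..T}" for t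
    unfolding C_def real_norm_def
  proof (rule ode_sol_perturbation(2)[OF E(1) E(1) _ _ S _ _ bb])
    fix x assume "x \<in> {a..b}"
    then have x: "\<bar>x + c\<bar> \<le> R" by (auto simp: R_def)
    show "\<bar>pot \<kappa> (sqrt t) c x\<bar> \<le> M"
      unfolding M_def using t by (intro pot_sqrt_bounds(1) x) auto
    show "\<bar>pot \<kappa> (sqrt t) c x - pot \<kappa> (sqrt s) c x\<bar> \<le> \<kappa>\<^sup>2 * R\<^sup>2 * \<bar>t - s\<bar>"
      using t s by (intro pot_sqrt_bounds(2)[OF _ _ x]) auto
  qed (use E in auto)
  then have "\<forall>\<^sub>F t in at s within {0..T}. norm (E' (sqrt t) b - E' (sqrt s) b)
      \<le> C * (\<kappa>\<^sup>2 * R\<^sup>2 * \<bar>t - s\<bar>)"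
    by (auto simp: eventually_at_filter)
  moreover have "((\<lambda>t. C * (\<kappa>\<^sup>2 * R\<^sup>2 * \<bar>t - s\<bar>)) \<longlongrightarrow> 0) (at s within {0..T})"
    by (auto intro!: tendsto_eq_intros)
  ultimately have "((\<lambda>t. E' (sqrt t) b - E' (sqrt s) b) \<longlongrightarrow> 0) (at s within {0..T})"
    by (rule Lim_null_comparison)
  then show "((\<lambda>t. E' (sqrt t) b) \<longlongrightarrow> E' (sqrt s) b) (at s within {0..T})"
    by (rule LIM_zero_cancel)
qed

text \<open>
  Comparison functions for shooting from the centre with \<open>u'(0) = 0\<close>: \<open>\<beta> = 0\<close> solves the equation
  exactly for \<open>h = \<kappa>\<close> and has negative slope at \<open>d\<close>, while \<open>\<beta> = 2 \<kappa>\<^sup>2 / d\<^sup>2\<close> has positive slope there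
  and is a subsolution for large \<open>h\<close>. This brackets the critical field.
\<close>
definition barrier :: "real \<Rightarrow> real \<Rightarrow> real \<Rightarrow> real" where
  "barrier \<kappa> \<beta> x = exp (- \<kappa>\<^sup>2 * x\<^sup>2 / 2 + \<beta> * x ^ 4 / 4)"

text \<open>With logarithmic derivative \<open>q = \<beta> x^3 - \<kappa>^2 x\<close>, the potential
  is \<open>q' + q^2\<close>.\<close>

lemma ode_sol_barrier:
  "ode_sol (\<lambda>x. 3 * \<beta> * x\<^sup>2 - \<kappa>\<^sup>2 + (\<beta> * x ^ 3 - \<kappa>\<^sup>2 * x)\<^sup>2)
     (barrier \<kappa> \<beta>) (\<lambda>x. (\<beta> * x ^ 3 - \<kappa>\<^sup>2 * x) * barrier \<kappa> \<beta> x)"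
proof -
  have *: "(barrier \<kappa> \<beta> has_real_derivative (\<beta> * x ^ 3 - \<kappa>\<^sup>2 * x) * barrier \<kappa> \<beta> x) (at x)" for x
    unfolding barrier_def by (auto intro!: derivative_eq_intros simp: algebra_simps)
  show ?thesis
    unfolding ode_sol_def
  proof (intro conjI allI *)
    fix x
    show "((\<lambda>x. (\<beta> * x ^ 3 - \<kappa>\<^sup>2 * x) * barrier \<kappa> \<beta> x) has_real_derivative
        (3 * \<beta> * x\<^sup>2 - \<kappa>\<^sup>2 + (\<beta> * x ^ 3 - \<kappa>\<^sup>2 * x)\<^sup>2) * barrier \<kappa> \<beta> x) (at x)"
      by (rule derivative_eq_intros * refl)+ (simp add: algebra_simps power2_eq_square)
  qed
qed

text \<open>The condition on \<open>\<beta>\<close> puts the barrier's potential below the true one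
  on \<open>[0,d]\<close>; both functions start at the centre with value 1 and slope 0, so Sturm
  comparison applies.\<close>

lemma even_solution_lower_bound:
  assumes E: "ode_sol (pot \<kappa> h 0) E E'" "E 0 = 1" "E' 0 = 0"
    and \<beta>: "\<beta> \<ge> 0" "3 * \<beta> + (\<kappa>\<^sup>2 + \<beta> * d\<^sup>2)\<^sup>2 \<le> \<kappa>\<^sup>2 * h\<^sup>2" and x: "x \<in> {0..d}"
  shows "E x > 0" "E' x \<ge> (\<beta> * x ^ 3 - \<kappa>\<^sup>2 * x) * E x"
proof -
  \<comment> \<open>The term \<open>- \<kappa>^2\<close> is common to both potentials, and the rest
    on each side carries the factor \<open>t^2\<close>; the hypothesis compares the
    cofactors.\<close>
  have le: "3 * \<beta> * t\<^sup>2 - \<kappa>\<^sup>2 + (\<beta> * t ^ 3 - \<kappa>\<^sup>2 * t)\<^sup>2 \<le> pot \<kappa> h 0 t" if t: "t \<in> {0..d}" for t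
  proof -
    have "\<bar>\<beta> * t\<^sup>2 - \<kappa>\<^sup>2\<bar> \<le> \<kappa>\<^sup>2 + \<beta> * d\<^sup>2"
    proof -
      have "0 \<le> \<beta> * t\<^sup>2" "\<beta> * t\<^sup>2 \<le> \<beta> * d\<^sup>2"
        using \<beta> t by (auto intro!: mult_left_mono power_mono)
      then show ?thesis using zero_le_power2[of \<kappa>] by linarith
    qed
    then have "(\<beta> * t\<^sup>2 - \<kappa>\<^sup>2)\<^sup>2 \<le> (\<kappa>\<^sup>2 + \<beta> * d\<^sup>2)\<^sup>2"
      by (metis abs_ge_zero abs_le_square_iff abs_of_nonneg order_trans)
    then have "t\<^sup>2 * (3 * \<beta> + (\<beta> * t\<^sup>2 - \<kappa>\<^sup>2)\<^sup>2) \<le> t\<^sup>2 * (\<kappa>\<^sup>2 * h\<^sup>2)"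
      using \<beta>(2) by (intro mult_left_mono) auto
    moreover have "t\<^sup>2 * (3 * \<beta> + (\<beta> * t\<^sup>2 - \<kappa>\<^sup>2)\<^sup>2) = 3 * \<beta> * t\<^sup>2 + (\<beta> * t ^ 3 - \<kappa>\<^sup>2 * t)\<^sup>2"
      by (simp add: algebra_simps power2_eq_square power3_eq_cube)
    ultimately show ?thesis by (simp add: pot_def algebra_simps)
  qed
  have pos: "barrier \<kappa> \<beta> t > 0" for t by (simp add: barrier_def)
  have init: "E 0 > 0" "barrier \<kappa> \<beta> 0 * E' 0 \<ge> E 0 * ((\<beta> * 0 ^ 3 - \<kappa>\<^sup>2 * 0) * barrier \<kappa> \<beta> 0)"
    using E by simp_all
  note S = sturm_comparison[OF ode_sol_barrier[of \<beta> \<kappa>] E(1) le pos init x]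
  show "E x > 0" by (rule S)
  have "barrier \<kappa> \<beta> x * ((\<beta> * x ^ 3 - \<kappa>\<^sup>2 * x) * E x) \<le> barrier \<kappa> \<beta> x * E' x"
    using S(2) by (simp add: mult_ac)
  then show "E' x \<ge> (\<beta> * x ^ 3 - \<kappa>\<^sup>2 * x) * E x" using pos[of x] by simp
qed

lemma ground_state_exists:
  assumes d: "d > 0" and \<kappa>: "\<kappa> > 0"
  shows "\<exists>h p p'. h > 0 \<and> ode_sol (pot \<kappa> h 0) p p' \<and> (\<forall>x\<in>{-d..d}. p x > 0)
    \<and> p d = 1 \<and> p' d = 0 \<and> p' 0 = 0"
proof -
  obtain E E' where E: "\<And>h. ode_sol (pot \<kappa> h 0) (E h) (E' h)" "\<And>h. E h 0 = 1" "\<And>h. E' h 0 = 0"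
    using ode_sol_pot_exists[of \<kappa> _ 0 0 1 0] by metis
  have pos: "E h x > 0" if "h \<ge> \<kappa>" "x \<in> {0..d}" for h x
  proof (rule even_solution_lower_bound(1)[OF E, where \<beta> = 0 and d = d])
    have "\<kappa>\<^sup>2 \<le> h\<^sup>2" using that(1) \<kappa> by (intro power_mono) auto
    then show "3 * 0 + (\<kappa>\<^sup>2 + 0 * d\<^sup>2)\<^sup>2 \<le> \<kappa>\<^sup>2 * h\<^sup>2"
      using mult_left_mono[of "\<kappa>\<^sup>2" "h\<^sup>2" "\<kappa>\<^sup>2"] by (simp add: power2_eq_square)
  qed (use that in auto)
  have dd: "d \<in> {0..d}" using d by simp
  have neg: "E' \<kappa> d < 0"
  proof -
    \<comment> \<open>For \<open>h = \<kappa>\<close> and \<open>\<beta> = 0\<close> the two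
      potentials coincide, so the comparison may also be run with the roles exchanged, giving an
      upper bound on the slope.\<close>
    have "E \<kappa> d * ((0 * d ^ 3 - \<kappa>\<^sup>2 * d) * barrier \<kappa> 0 d) \<ge> barrier \<kappa> 0 d * E' \<kappa> d"
      by (rule sturm_comparison(2)[OF E(1)[of \<kappa>] ode_sol_barrier[of 0 \<kappa>] _ pos _ _ dd])
        (auto simp: pot_def barrier_def E algebra_simps power2_eq_square)
    then have "barrier \<kappa> 0 d * (- \<kappa>\<^sup>2 * d * E \<kappa> d) \<ge> barrier \<kappa> 0 d * E' \<kappa> d"
      by (simp add: mult_ac)
    moreover have "barrier \<kappa> 0 d > 0" by (simp add: barrier_def)
    ultimately have "E' \<kappa> d \<le> - \<kappa>\<^sup>2 * d * E \<kappa> d" by (simp only: mult_le_cancel_left_pos)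
    also have "\<dots> < 0" using pos[OF order_refl dd] d \<kappa> by simp
    finally show ?thesis .
  qed
  \<comment> \<open>This value turns the condition on \<open>\<beta> = 2 \<kappa>^2 / d^2\<close>
    into an equality: \<open>3 \<beta> + (3 \<kappa>^2)^2 = \<kappa>^2 H^2\<close>.\<close>
  define H where "H = sqrt (6 / d\<^sup>2 + 9 * \<kappa>\<^sup>2)"
  have H2: "H\<^sup>2 = 6 / d\<^sup>2 + 9 * \<kappa>\<^sup>2" unfolding H_def by simp
  have \<kappa>H: "\<kappa> \<le> H"
    unfolding H_def using \<kappa> by (intro real_le_rsqrt) (simp add: add_nonneg_nonneg)
  have posH: "E' H d > 0"
  proof -
    define \<beta> where "\<beta> = 2 * \<kappa>\<^sup>2 / d\<^sup>2"
    have \<beta>d: "\<beta> * d\<^sup>2 = 2 * \<kappa>\<^sup>2" unfolding \<beta>_def using d by simp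
    have cond: "3 * \<beta> + (\<kappa>\<^sup>2 + \<beta> * d\<^sup>2)\<^sup>2 = \<kappa>\<^sup>2 * H\<^sup>2"
      unfolding \<beta>d H2 by (simp add: \<beta>_def algebra_simps power2_eq_square)
    have "(\<beta> * d ^ 3 - \<kappa>\<^sup>2 * d) * E H d \<le> E' H d"
      by (rule even_solution_lower_bound(2)[OF E _ _ dd])
        (use cond in \<open>auto simp: \<beta>_def\<close>)
    moreover have "\<beta> * d ^ 3 - \<kappa>\<^sup>2 * d = \<kappa>\<^sup>2 * d"
      unfolding \<beta>_def using d by (simp add: field_simps power2_eq_square power3_eq_cube)
    moreover have "\<kappa>\<^sup>2 * d * E H d > 0" using pos[OF \<kappa>H dd] d \<kappa> by simp
    ultimately show ?thesis by simp
  qed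
  have "continuous_on {0..H\<^sup>2} (\<lambda>t. E' (sqrt t) d)"
    using d by (intro shooting_continuous[OF E, where b = d]) auto
  then have "continuous_on {\<kappa>\<^sup>2..H\<^sup>2} (\<lambda>t. E' (sqrt t) d)"
    by (rule continuous_on_subset) auto
  moreover have "sqrt (\<kappa>\<^sup>2) = \<kappa>" "sqrt (H\<^sup>2) = H" "\<kappa>\<^sup>2 \<le> H\<^sup>2"
    using \<kappa> \<kappa>H by (auto intro: power_mono)
  ultimately obtain t where t: "t \<ge> \<kappa>\<^sup>2" "E' (sqrt t) d = 0"
    using IVT'[of "\<lambda>t. E' (sqrt t) d" "\<kappa>\<^sup>2" 0 "H\<^sup>2"] neg posH by auto
  define h where "h = sqrt t"
  have h: "h \<ge> \<kappa>" "E' h d = 0"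
    using t by (auto simp: h_def intro: real_le_rsqrt)
  have Ed: "E h d > 0" by (rule pos[OF h(1) dd])
  have "E h x > 0" if "x \<in> {-d..d}" for x
    using pos[OF h(1), of x] pos[OF h(1), of "-x"] that
      ode_sol_even(1)[OF E(1) continuous_on_pot pot_even E(3), of h x] by (cases "x \<ge> 0") auto
  then show ?thesis
    using ode_sol_scale[OF E(1)[of h], of "1 / E h d"] h \<kappa> Ed E(3)
    by (intro exI[of _ h] exI[of _ "\<lambda>x. 1 / E h d * E h x"] exI[of _ "\<lambda>x. 1 / E h d * E' h x"]) auto
qed

section \<open>Persistence of the ground state for small \<open>c\<close>\<close>

text \<open>
  The constant \<open>C1\<close> in the proof is chosen so that the shooting slope at \<open>d\<close> has opposite signs for
  \<open>k\<^sup>2 = h\<^sup>2 \<plusminus> C1 \<bar>c\<bar>\<close>; the signs are read off the Wronskian with the unperturbed solution.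
\<close>
lemma perturbed_ground_state:
  assumes d: "d > 0" and \<kappa>: "\<kappa> > 0" and h: "h > 0"
    and p: "ode_sol (pot \<kappa> h 0) p p'" and ppos: "\<And>x. x \<in> {-d..d} \<Longrightarrow> p x > 0"
    and p_bd: "p (-d) = 1" "p' (-d) = 0" "p' d = 0"
  shows "\<exists>\<delta>>0. \<exists>C>0. \<forall>c. \<bar>c\<bar> < \<delta> \<longrightarrow> (\<exists>k u u'. k > 0 \<and> ode_sol (pot \<kappa> k c) u u' \<and>
    u (-d) = 1 \<and> u' (-d) = 0 \<and> u' d = 0 \<and> (\<forall>x\<in>{-d..d}. u x > 0) \<and>
    \<bar>k\<^sup>2 - h\<^sup>2\<bar> \<le> C * \<bar>c\<bar> \<and> (\<forall>x\<in>{-d..d}. \<bar>u x - p x\<bar> \<le> C * \<bar>c\<bar>))"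
proof -
  have contp: "continuous_on {-d..d} p" by (rule ode_sol_continuous[OF p])
  obtain S where S: "S > 0" "\<And>x. x \<in> {-d..d} \<Longrightarrow> \<bar>p x\<bar> \<le> S"
    by (rule continuous_bounded_on_interval[OF contp]) blast
  obtain z where z: "z \<in> {-d..d}" "\<And>x. x \<in> {-d..d} \<Longrightarrow> p z \<le> p x"
    using continuous_attains_inf[OF compact_Icc _ contp] d by auto
  define m where "m = p z"
  have m: "m > 0" "\<And>x. x \<in> {-d..d} \<Longrightarrow> m \<le> p x" using z ppos unfolding m_def by auto
  have mS: "m \<le> S" using m(2)[of d] S(2)[of d] d by auto
  \<comment> \<open>The factor 36 balances the final estimate: the gain
    \<open>C1 m^2 d^3 / 3\<close> from moving the field then equals the possible loss
    \<open>12 h^2 S^2 d^2\<close> from moving the centre.\<close>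
  define C1 where "C1 = 36 * h\<^sup>2 * S\<^sup>2 / (m\<^sup>2 * d)"
  have C1: "C1 > 0" unfolding C1_def using h S m d by simp
  have C1eq: "C1 * m\<^sup>2 * d = 36 * h\<^sup>2 * S\<^sup>2" unfolding C1_def using m d by simp
  define M where "M = \<kappa>\<^sup>2 * ((h\<^sup>2 + 1) * (2 * d)\<^sup>2 + 1)"
  define P where "P = sqrt ((d - (-d)) * exp ((M + 2) * (d - (-d)))) * S"
  have P: "P > 0" unfolding P_def using S d by simp
  \<comment> \<open>\<open>A \<bar>c\<bar>\<close> bounds the change of the potential when
    \<open>\<bar>t - h^2\<bar> \<le> C1 \<bar>c\<bar>\<close>, using
    \<open>\<bar>x + c\<bar> \<le> 2 d\<close> and
    \<open>\<bar>2 x + c\<bar> \<le> 3 d\<close>.\<close>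
  define A where "A = \<kappa>\<^sup>2 * ((2 * d)\<^sup>2 * C1 + 3 * d * h\<^sup>2)"
  have A: "A > 0" unfolding A_def using \<kappa> d h C1 by (simp add: add_pos_pos)
  \<comment> \<open>The three bounds keep \<open>\<bar>c\<bar> \<le> d\<close>, keep the shot
    solutions within \<open>m / 2\<close> of \<open>p\<close>, and keep \<open>t\<close> positive
    and at most \<open>h^2 + 1\<close>.\<close>
  define \<delta> where "\<delta> = min d (min (m / (2 * P * A)) (min 1 (h\<^sup>2 / 2) / C1))"
  have \<delta>: "\<delta> > 0" unfolding \<delta>_def using d m P A C1 h by simp
  define C where "C = C1 + P * A"
  have C: "C > 0" unfolding C_def using C1 P A by (simp add: add_pos_pos)
  have main: "\<exists>k u u'. k > 0 \<and> ode_sol (pot \<kappa> k c) u u' \<and>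
    u (-d) = 1 \<and> u' (-d) = 0 \<and> u' d = 0 \<and> (\<forall>x\<in>{-d..d}. u x > 0) \<and>
    \<bar>k\<^sup>2 - h\<^sup>2\<bar> \<le> C * \<bar>c\<bar> \<and> (\<forall>x\<in>{-d..d}. \<bar>u x - p x\<bar> \<le> C * \<bar>c\<bar>)" if c: "\<bar>c\<bar> < \<delta>" for c
  proof -
    have cd: "\<bar>c\<bar> \<le> d" using c unfolding \<delta>_def by simp
    have "\<bar>c\<bar> < m / (2 * P * A)" using c unfolding \<delta>_def by simp
    then have cm: "P * (A * \<bar>c\<bar>) \<le> m / 2" using P A by (simp add: field_simps)
    have "\<bar>c\<bar> < min 1 (h\<^sup>2 / 2) / C1" using c unfolding \<delta>_def by simp
    then have "C1 * \<bar>c\<bar> \<le> min 1 (h\<^sup>2 / 2)" using C1 by (simp add: field_simps)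
    then have ch: "C1 * \<bar>c\<bar> \<le> 1" "C1 * \<bar>c\<bar> \<le> h\<^sup>2 / 2" by auto
    obtain E E' where E: "\<And>k. ode_sol (pot \<kappa> k c) (E k) (E' k)"
      "\<And>k. E k (-d) = 1" "\<And>k. E' k (-d) = 0"
      using ode_sol_pot_exists[of \<kappa> _ c "-d" 1 0] by metis
    define J where "J = {h\<^sup>2 - C1 * \<bar>c\<bar>..h\<^sup>2 + C1 * \<bar>c\<bar>}"
    have J: "t > 0" "t \<le> h\<^sup>2 + 1" "\<bar>t - h\<^sup>2\<bar> \<le> C1 * \<bar>c\<bar>" if "t \<in> J" for t
    proof -
      have h2: "h\<^sup>2 > 0" using h by simp
      have b: "h\<^sup>2 - C1 * \<bar>c\<bar> \<le> t" "t \<le> h\<^sup>2 + C1 * \<bar>c\<bar>" using that unfolding J_def by auto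
      show "t > 0" "t \<le> h\<^sup>2 + 1" using b ch h2 by linarith+
      show "\<bar>t - h\<^sup>2\<bar> \<le> C1 * \<bar>c\<bar>" using b unfolding abs_le_iff by linarith
    qed
    have diff: "pot \<kappa> (sqrt t) c x - pot \<kappa> h 0 x
        = \<kappa>\<^sup>2 * ((t - h\<^sup>2) * (x + c)\<^sup>2 + h\<^sup>2 * c * (2 * x + c))" if "t \<ge> 0" for t x
      using that by (simp add: pot_def algebra_simps power2_eq_square)
    have close: "\<bar>E (sqrt t) x - p x\<bar> \<le> P * (A * \<bar>c\<bar>)" if t: "t \<in> J" and x: "x \<in> {-d..d}" for t x
      unfolding P_def
    proof (rule ode_sol_perturbation(1)[OF E(1) p _ _ S(2) _ _ x])
      fix y assume y: "y \<in> {-d..d}"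
      have yc: "\<bar>y + c\<bar> \<le> 2 * d" "\<bar>2 * y + c\<bar> \<le> 3 * d" using y cd by auto
      show "\<bar>pot \<kappa> (sqrt t) c y\<bar> \<le> M"
        unfolding M_def using J[OF t] by (intro pot_sqrt_bounds(1) yc) auto
      have y2: "(y + c)\<^sup>2 \<le> (2 * d)\<^sup>2" using power_mono[OF yc(1), of 2] by simp
      have "\<bar>(t - h\<^sup>2) * (y + c)\<^sup>2 + h\<^sup>2 * c * (2 * y + c)\<bar>
          \<le> \<bar>t - h\<^sup>2\<bar> * (y + c)\<^sup>2 + h\<^sup>2 * \<bar>c\<bar> * \<bar>2 * y + c\<bar>"
        by (rule order_trans[OF abs_triangle_ineq]) (simp add: abs_mult)
      also have "\<dots> \<le> (C1 * \<bar>c\<bar>) * (2 * d)\<^sup>2 + h\<^sup>2 * \<bar>c\<bar> * (3 * d)"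
        using J(3)[OF t] y2 yc(2) by (intro add_mono mult_mono) (auto intro: mult_left_mono)
      finally have "\<bar>(t - h\<^sup>2) * (y + c)\<^sup>2 + h\<^sup>2 * c * (2 * y + c)\<bar>
          \<le> (C1 * \<bar>c\<bar>) * (2 * d)\<^sup>2 + h\<^sup>2 * \<bar>c\<bar> * (3 * d)" .
      then have "\<kappa>\<^sup>2 * \<bar>(t - h\<^sup>2) * (y + c)\<^sup>2 + h\<^sup>2 * c * (2 * y + c)\<bar>
          \<le> \<kappa>\<^sup>2 * ((C1 * \<bar>c\<bar>) * (2 * d)\<^sup>2 + h\<^sup>2 * \<bar>c\<bar> * (3 * d))"
        by (intro mult_left_mono) auto
      also have "\<dots> = A * \<bar>c\<bar>" unfolding A_def by (simp add: algebra_simps)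
      finally show "\<bar>pot \<kappa> (sqrt t) c y - pot \<kappa> h 0 y\<bar> \<le> A * \<bar>c\<bar>"
        using diff[of t y] J(1)[OF t] by (simp add: abs_mult)
    qed (use E p_bd in auto)
    have Ebd: "m / 2 \<le> E (sqrt t) x" "E (sqrt t) x \<le> 2 * S" if t: "t \<in> J" and x: "x \<in> {-d..d}" for t x
    proof -
      show "m / 2 \<le> E (sqrt t) x" using close[OF t x] cm m(2)[OF x] by linarith
      show "E (sqrt t) x \<le> 2 * S" using close[OF t x] cm S(2)[OF x] mS m(1) by linarith
    qed
    have sign: "\<sigma> * E' (sqrt (h\<^sup>2 + \<sigma> * (C1 * \<bar>c\<bar>))) d \<ge> 0" if \<sigma>: "\<sigma> = 1 \<or> \<sigma> = -1" for \<sigma> :: real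
    proof -
      define t where "t = h\<^sup>2 + \<sigma> * (C1 * \<bar>c\<bar>)"
      define u where "u = E (sqrt t)"
      define u' where "u' = E' (sqrt t)"
      have tJ: "t \<in> J" using \<sigma> C1 unfolding t_def J_def by auto
      have \<sigma>2: "\<sigma> * \<sigma> = 1" "\<bar>\<sigma>\<bar> = 1" using \<sigma> by auto
      have u: "ode_sol (pot \<kappa> (sqrt t) c) u u'" unfolding u_def u'_def by (rule E)
      define a where "a = \<kappa>\<^sup>2 * \<bar>c\<bar>"
      have a0: "a \<ge> 0" unfolding a_def by simp
      \<comment> \<open>The signed Wronskian minus an antiderivative of a lower bound for its
        derivative. Monotonicity of \<open>F\<close> then bounds the signed slope at
        \<open>d\<close> from below, for both choices of \<open>\<sigma>\<close> at once.\<close>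
      define F where "F x = \<sigma> * (p x * u' x - u x * p' x)
        - a * (C1 * (m\<^sup>2 / 2) * ((x + c) ^ 3 / 3) - h\<^sup>2 * (3 * d) * (2 * S\<^sup>2) * x)" for x
      have "F (-d) \<le> F d"
      proof (rule DERIV_nonneg_imp_nondecreasing[where f = F])
        fix x assume "-d \<le> x" "x \<le> d"
        then have x: "x \<in> {-d..d}" by simp
        define r where "r = p x * u x"
        have r: "m\<^sup>2 / 2 \<le> r" "r \<le> 2 * S\<^sup>2"
        proof -
          have "m * (m / 2) \<le> p x * u x"
            unfolding u_def using m(2)[OF x] Ebd[OF tJ x] m(1) by (intro mult_mono) auto
          then show "m\<^sup>2 / 2 \<le> r" unfolding r_def by (simp add: power2_eq_square)
          have "p x * u x \<le> S * (2 * S)"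
            unfolding u_def using S(2)[OF x] Ebd[OF tJ x] S(1) m(1) by (intro mult_mono) auto
          then show "r \<le> 2 * S\<^sup>2" unfolding r_def by (simp add: power2_eq_square)
        qed
        define y where "y = \<sigma> * ((pot \<kappa> (sqrt t) c x - pot \<kappa> h 0 x) * p x * u x)
          - a * (C1 * (m\<^sup>2 / 2) * (x + c)\<^sup>2 - h\<^sup>2 * (3 * d) * (2 * S\<^sup>2))"
        have W: "((\<lambda>x. p x * u' x - u x * p' x) has_real_derivative
            (pot \<kappa> (sqrt t) c x - pot \<kappa> h 0 x) * p x * u x) (at x)"
          by (intro wronskian_deriv ode_sol_deriv[OF p] ode_sol_deriv[OF u])
        have cubic: "((\<lambda>x. \<alpha> * ((x + c) ^ 3 / 3) - \<beta> * x) has_real_derivative \<alpha> * (x + c)\<^sup>2 - \<beta>) (at x)"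
          for \<alpha> \<beta> :: real
          by (auto intro!: derivative_eq_intros simp: power2_eq_square)
        have "(F has_real_derivative y) (at x)"
          unfolding F_def y_def by (intro DERIV_diff DERIV_cmult W cubic)
        moreover have "y \<ge> 0"
        proof -
          have e: "\<sigma> * ((pot \<kappa> (sqrt t) c x - pot \<kappa> h 0 x) * p x * u x)
            = \<kappa>\<^sup>2 * ((C1 * \<bar>c\<bar>) * (x + c)\<^sup>2 * r + \<sigma> * (h\<^sup>2 * c * (2 * x + c)) * r)"
          proof -
            have "t - h\<^sup>2 = \<sigma> * (C1 * \<bar>c\<bar>)" by (simp add: t_def)
            then have "\<sigma> * ((pot \<kappa> (sqrt t) c x - pot \<kappa> h 0 x) * p x * u x)
              = \<kappa>\<^sup>2 * ((\<sigma> * \<sigma>) * (C1 * \<bar>c\<bar>) * (x + c)\<^sup>2 * r + \<sigma> * (h\<^sup>2 * c * (2 * x + c)) * r)"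
              unfolding diff[OF less_imp_le[OF J(1)[OF tJ]]] r_def by (simp add: algebra_simps)
            then show ?thesis by (simp add: \<sigma>2)
          qed
          have "(C1 * \<bar>c\<bar>) * (x + c)\<^sup>2 * r \<ge> (C1 * \<bar>c\<bar>) * (x + c)\<^sup>2 * (m\<^sup>2 / 2)"
            using r(1) C1 by (intro mult_left_mono) auto
          moreover have "\<sigma> * (h\<^sup>2 * c * (2 * x + c)) * r \<ge> - (h\<^sup>2 * \<bar>c\<bar> * (3 * d) * (2 * S\<^sup>2))"
          proof -
            have "\<bar>\<sigma> * (h\<^sup>2 * c * (2 * x + c)) * r\<bar> = h\<^sup>2 * \<bar>c\<bar> * \<bar>2 * x + c\<bar> * \<bar>r\<bar>"
              by (simp add: abs_mult \<sigma>2)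
            also have "\<dots> \<le> h\<^sup>2 * \<bar>c\<bar> * (3 * d) * (2 * S\<^sup>2)"
            proof (intro mult_mono)
              show "\<bar>2 * x + c\<bar> \<le> 3 * d" using x cd by auto
              have "0 \<le> m\<^sup>2 / 2" by simp
              then show "\<bar>r\<bar> \<le> 2 * S\<^sup>2" using r by linarith
            qed (use d in auto)
            finally show ?thesis by linarith
          qed
          ultimately have "(C1 * \<bar>c\<bar>) * (x + c)\<^sup>2 * (m\<^sup>2 / 2) - h\<^sup>2 * \<bar>c\<bar> * (3 * d) * (2 * S\<^sup>2)
            \<le> (C1 * \<bar>c\<bar>) * (x + c)\<^sup>2 * r + \<sigma> * (h\<^sup>2 * c * (2 * x + c)) * r"
            by linarith
          then have "\<kappa>\<^sup>2 * ((C1 * \<bar>c\<bar>) * (x + c)\<^sup>2 * (m\<^sup>2 / 2) - h\<^sup>2 * \<bar>c\<bar> * (3 * d) * (2 * S\<^sup>2))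
            \<le> \<sigma> * ((pot \<kappa> (sqrt t) c x - pot \<kappa> h 0 x) * p x * u x)"
            unfolding e by (intro mult_left_mono) auto
          then show ?thesis unfolding y_def a_def by (simp add: algebra_simps)
        qed
        ultimately show "\<exists>y. (F has_real_derivative y) (at x) \<and> 0 \<le> y" by blast
      qed (use d in auto)
      moreover have "F (-d) = - a * (C1 * (m\<^sup>2 / 2) * ((-d + c) ^ 3 / 3) + h\<^sup>2 * (3 * d) * (2 * S\<^sup>2) * d)"
        unfolding F_def using p_bd E by (simp add: u_def u'_def)
      moreover have "F d = \<sigma> * (p d * u' d)
          - a * (C1 * (m\<^sup>2 / 2) * ((d + c) ^ 3 / 3) - h\<^sup>2 * (3 * d) * (2 * S\<^sup>2) * d)"
        unfolding F_def using p_bd by simp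
      ultimately have "a * (C1 * (m\<^sup>2 / 2) * (((d + c) ^ 3 - (c - d) ^ 3) / 3)
          - 2 * (h\<^sup>2 * (3 * d) * (2 * S\<^sup>2) * d)) \<le> \<sigma> * (p d * u' d)"
        by (simp add: algebra_simps)
      moreover have "C1 * (m\<^sup>2 / 2) * (((d + c) ^ 3 - (c - d) ^ 3) / 3)
          - 2 * (h\<^sup>2 * (3 * d) * (2 * S\<^sup>2) * d) \<ge> 0"
      proof -
        have "((d + c) ^ 3 - (c - d) ^ 3) / 3 = 2 * d ^ 3 / 3 + 2 * d * c\<^sup>2"
          by (simp add: algebra_simps power3_eq_cube power2_eq_square)
        also have "\<dots> \<ge> 2 * d ^ 3 / 3" using d by simp
        finally have "C1 * (m\<^sup>2 / 2) * (((d + c) ^ 3 - (c - d) ^ 3) / 3) \<ge> C1 * (m\<^sup>2 / 2) * (2 * d ^ 3 / 3)"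
          using C1 by (intro mult_left_mono) auto
        moreover have "C1 * (m\<^sup>2 / 2) * (2 * d ^ 3 / 3) = (C1 * m\<^sup>2 * d) * d\<^sup>2 / 3"
          by (simp add: power2_eq_square power3_eq_cube)
        moreover have "2 * (h\<^sup>2 * (3 * d) * (2 * S\<^sup>2) * d) = 12 * h\<^sup>2 * S\<^sup>2 * d\<^sup>2"
          by (simp add: power2_eq_square)
        moreover have "(C1 * m\<^sup>2 * d) * d\<^sup>2 / 3 = 12 * h\<^sup>2 * S\<^sup>2 * d\<^sup>2"
          unfolding C1eq by simp
        ultimately show ?thesis by linarith
      qed
      ultimately have "\<sigma> * (p d * u' d) \<ge> 0" using a0 by (meson mult_nonneg_nonneg order_trans)
      then have "p d * (\<sigma> * u' d) \<ge> 0" by (simp add: mult_ac)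
      moreover have "p d > 0" using ppos d by simp
      ultimately have "\<sigma> * u' d \<ge> 0" by (simp add: zero_le_mult_iff)
      then show ?thesis unfolding u'_def t_def .
    qed
    have "continuous_on {0..h\<^sup>2 + 1} (\<lambda>t. E' (sqrt t) d)"
      using d by (intro shooting_continuous[OF E]) auto
    then have "continuous_on J (\<lambda>t. E' (sqrt t) d)"
      by (rule continuous_on_subset) (use J(1,2) in \<open>fastforce simp: less_imp_le\<close>)
    moreover have "E' (sqrt (h\<^sup>2 + C1 * \<bar>c\<bar>)) d \<ge> 0" "E' (sqrt (h\<^sup>2 - C1 * \<bar>c\<bar>)) d \<le> 0"
      using sign[of 1] sign[of "-1"] by simp_all
    moreover have "h\<^sup>2 - C1 * \<bar>c\<bar> \<le> h\<^sup>2 + C1 * \<bar>c\<bar>" using C1 by simp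
    ultimately obtain t where "t \<ge> h\<^sup>2 - C1 * \<bar>c\<bar>" "t \<le> h\<^sup>2 + C1 * \<bar>c\<bar>" and t0: "E' (sqrt t) d = 0"
      using IVT'[of "\<lambda>t. E' (sqrt t) d" "h\<^sup>2 - C1 * \<bar>c\<bar>" 0 "h\<^sup>2 + C1 * \<bar>c\<bar>"]
      unfolding J_def by auto
    then have tJ: "t \<in> J" unfolding J_def by simp
    have cc: "C1 * \<bar>c\<bar> \<le> C * \<bar>c\<bar>" "P * (A * \<bar>c\<bar>) \<le> C * \<bar>c\<bar>"
      unfolding C_def using P A C1 by (simp_all add: algebra_simps)
    have "sqrt t > 0" using J(1)[OF tJ] by simp
    moreover have "\<forall>x\<in>{-d..d}. E (sqrt t) x > 0" using Ebd(1)[OF tJ] m(1) by force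
    moreover have "\<bar>(sqrt t)\<^sup>2 - h\<^sup>2\<bar> \<le> C * \<bar>c\<bar>" using J[OF tJ] cc(1) by simp
    moreover have "\<forall>x\<in>{-d..d}. \<bar>E (sqrt t) x - p x\<bar> \<le> C * \<bar>c\<bar>"
      using close[OF tJ] cc(2) by force
    ultimately show ?thesis using E t0 by blast
  qed
  show ?thesis using \<delta> C main by blast
qed

subsection \<open>The derivative of the integral at zero\<close>

lemma has_integral_odd:
  fixes f :: "real \<Rightarrow> real"
  assumes cont: "continuous_on {-d..d} f" and odd: "\<And>x. f (- x) = - f x"
  shows "(f has_integral 0) {-d..d}"
proof -
  obtain i where i: "(f has_integral i) {-d..d}"
    using integrable_continuous_interval[OF cont] by blast
  have "((\<lambda>x. f (- x)) has_integral i) {-d..d}"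
    using has_integral_reflect_real[where f = f and a = "-d" and b = d] i by simp
  then have "((\<lambda>x. - f x) has_integral i) {-d..d}" by (simp only: odd)
  from has_integral_neg[OF this] have "(f has_integral - i) {-d..d}" by simp
  then have "i = - i" using i has_integral_unique by blast
  then show ?thesis using i by simp
qed

text \<open>Stated, like its additive companion, as an introduction rule, so that a bound for a
  polynomial expression can be assembled along its syntax tree.\<close>

lemma abs_mult_le_mult:
  fixes x y :: real
  shows "\<bar>x\<bar> \<le> a \<Longrightarrow> \<bar>y\<bar> \<le> b \<Longrightarrow> \<bar>x * y\<bar> \<le> a * b"
  unfolding abs_mult by (rule mult_mono) auto

lemma abs_add_le_add:
  fixes x y :: real
  shows "\<bar>x\<bar> \<le> a \<Longrightarrow> \<bar>y\<bar> \<le> b \<Longrightarrow> \<bar>x + y\<bar> \<le> a + b"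
  by linarith

text \<open>Three integrals vanish: two by parity, one because the Wronskian of \<open>X\<close>
  with the exact perturbed solution is zero at both ends. Adding multiples of them to the integrand
  of \<open>I(c) - c D\<close> leaves a pointwise \<open>O(c^2)\<close> remainder.\<close>

lemma I_fun_has_derivative_at_0:
  assumes d: "d > 0" and \<kappa>: "\<kappa> > 0" and h: "h > 0"
    and p: "ode_sol (pot \<kappa> h 0) p p'" and ppos: "\<And>x. x \<in> {-d..d} \<Longrightarrow> p x > 0"
    and p_bd: "p (-d) = 1" "p' (-d) = 0" "p' d = 0"
    and p_even: "\<And>x. p (- x) = p x"
    and X: "\<And>x. (X has_real_derivative X' x) (at x)"
      "\<And>x. (X' has_real_derivative pot \<kappa> h 0 x * X x + 2 * \<kappa>\<^sup>2 * h\<^sup>2 * x * p x) (at x)"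
    and X_bd: "X' (-d) = 0" "X' d = 0" and X_odd: "\<And>x. X (- x) = - X x"
    and D: "((\<lambda>x. (p x)\<^sup>2 + 2 * x * X x * p x) has_integral D) {-d..d}"
  shows "(I_fun \<kappa> d has_real_derivative D) (at 0)"
proof -
  have contp: "continuous_on {-d..d} p" by (rule ode_sol_continuous[OF p])
  have contX: "continuous_on {-d..d} X"
    by (rule DERIV_continuous_on[OF has_field_derivative_at_within[OF X(1)]])
  obtain S where S: "\<And>x. x \<in> {-d..d} \<Longrightarrow> \<bar>p x\<bar> \<le> S"
    by (rule continuous_bounded_on_interval[OF contp]) blast
  obtain Y where Y: "\<And>x. x \<in> {-d..d} \<Longrightarrow> \<bar>X x\<bar> \<le> Y"
    by (rule continuous_bounded_on_interval[OF contX]) blast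
  obtain \<delta> C where \<delta>: "\<delta> > 0" and C: "C > 0" and
    pert: "\<And>c. \<bar>c\<bar> < \<delta> \<Longrightarrow> \<exists>k u u'. k > 0 \<and> ode_sol (pot \<kappa> k c) u u' \<and>
    u (-d) = 1 \<and> u' (-d) = 0 \<and> u' d = 0 \<and> (\<forall>x\<in>{-d..d}. u x > 0) \<and>
    \<bar>k\<^sup>2 - h\<^sup>2\<bar> \<le> C * \<bar>c\<bar> \<and> (\<forall>x\<in>{-d..d}. \<bar>u x - p x\<bar> \<le> C * \<bar>c\<bar>)"
    using perturbed_ground_state[OF d \<kappa> h p ppos p_bd] by blast
  define S' where "S' = S + C"
  define K where "K = C * (S' + S) + d * (C * C)
      + C * (1 / h\<^sup>2) * Y * (d * d * C + (2 * d + 1) * S') + Y * (2 * d * C + S')"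
  have main: "\<bar>I_fun \<kappa> d c - c * D\<bar> \<le> K * c\<^sup>2 * (2 * d)" if c: "\<bar>c\<bar> < \<delta>" "\<bar>c\<bar> \<le> 1" for c
  proof -
    obtain k u u' where k: "k > 0" and u: "ode_sol (pot \<kappa> k c) u u'"
      and u_bd: "u (-d) = 1" "u' (-d) = 0" "u' d = 0" and upos: "\<And>x. x \<in> {-d..d} \<Longrightarrow> u x > 0"
      and kh: "\<bar>k\<^sup>2 - h\<^sup>2\<bar> \<le> C * \<bar>c\<bar>" and up: "\<And>x. x \<in> {-d..d} \<Longrightarrow> \<bar>u x - p x\<bar> \<le> C * \<bar>c\<bar>"
      using pert[OF c(1)] by blast
    have psol: "positive_solution \<kappa> d k c u" by (rule positive_solutionI[OF u u_bd upos])
    have contu: "continuous_on {-d..d} u" by (rule ode_sol_continuous[OF u])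
    have I: "((\<lambda>x. (x + c) * (u x)\<^sup>2) has_integral I_fun \<kappa> d c) {-d..d}"
    proof -
      have "I_fun \<kappa> d c = integral {-d..d} (\<lambda>x. (x + c) * (u x)\<^sup>2)"
        unfolding I_fun_def
        by (intro integral_cong) (simp add: crit_h_psi0_eq(2)[OF d \<kappa> k psol])
      moreover have "(\<lambda>x. (x + c) * (u x)\<^sup>2) integrable_on {-d..d}"
        by (intro integrable_continuous_interval continuous_intros contu)
      ultimately show ?thesis by (simp add: has_integral_integral)
    qed
    define t where "t = k\<^sup>2 - h\<^sup>2"
    have i1: "((\<lambda>x. x * (p x)\<^sup>2) has_integral 0) {-d..d}"
      by (intro has_integral_odd continuous_intros contp) (simp add: p_even)
    have i2: "((\<lambda>x. X x * x\<^sup>2 * p x) has_integral 0) {-d..d}"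
      by (intro has_integral_odd continuous_intros contp contX) (simp add: p_even X_odd)
    have i3: "((\<lambda>x. X x * (pot \<kappa> k c x - pot \<kappa> h 0 x) * u x - 2 * \<kappa>\<^sup>2 * h\<^sup>2 * x * p x * u x)
        has_integral 0) {-d..d}"
    proof -
      define W where "W x = X x * u' x - u x * X' x" for x
      have "(W has_real_derivative
          X x * (pot \<kappa> k c x - pot \<kappa> h 0 x) * u x - 2 * \<kappa>\<^sup>2 * h\<^sup>2 * x * p x * u x) (at x)" for x
      proof -
        have "(W has_real_derivative (X' x * u' x + (pot \<kappa> k c x * u x) * X x)
            - (u' x * X' x + (pot \<kappa> h 0 x * X x + 2 * \<kappa>\<^sup>2 * h\<^sup>2 * x * p x) * u x)) (at x)"
          unfolding W_def by (intro DERIV_diff DERIV_mult X ode_sol_deriv[OF u])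
        then show ?thesis by (simp add: algebra_simps)
      qed
      then have "((\<lambda>x. X x * (pot \<kappa> k c x - pot \<kappa> h 0 x) * u x - 2 * \<kappa>\<^sup>2 * h\<^sup>2 * x * p x * u x)
          has_integral (W d - W (-d))) {-d..d}"
        using d by (intro fundamental_theorem_of_calculus)
          (auto simp: has_real_derivative_iff_has_vector_derivative[symmetric]
            intro: has_field_derivative_at_within)
      moreover have "W d - W (-d) = 0" using u_bd X_bd by (simp add: W_def)
      ultimately show ?thesis by simp
    qed
    \<comment> \<open>The added terms complete squares:
      \<open>x u^2 + x p^2 - 2 x p u = x (u - p)^2\<close>. The contribution
      \<open>t X x^2 p / h^2\<close>, which is only of first order, is removed by its odd
      integrand.\<close>
    define R where "R x = (x + c) * (u x)\<^sup>2 - c * ((p x)\<^sup>2 + 2 * x * X x * p x) + x * (p x)\<^sup>2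
      + inverse (\<kappa>\<^sup>2 * h\<^sup>2) * (X x * (pot \<kappa> k c x - pot \<kappa> h 0 x) * u x - 2 * \<kappa>\<^sup>2 * h\<^sup>2 * x * p x * u x)
      - t * (1 / h\<^sup>2) * (X x * x\<^sup>2 * p x)" for x
    have "(R has_integral (I_fun \<kappa> d c - c * D + 0 + inverse (\<kappa>\<^sup>2 * h\<^sup>2) * 0 - t * (1 / h\<^sup>2) * 0)) {-d..d}"
      unfolding R_def
      by (intro has_integral_add has_integral_diff has_integral_mult_right I D i1 i2 i3)
    then have Rint: "(R has_integral (I_fun \<kappa> d c - c * D)) {-d..d}" by simp
    have Rbd: "norm (R x) \<le> K * c\<^sup>2" if x: "x \<in> {-d..d}" for x
    proof -
      \<comment> \<open>Writing \<open>u - p = c a\<close> and \<open>t = c b\<close> with bounded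
        \<open>a\<close>, \<open>b\<close> makes the factor \<open>c^2\<close> a matter of algebra;
        for \<open>c = 0\<close> both quotients are replaced by 0.\<close>
      obtain a where a: "u x - p x = c * a" "\<bar>a\<bar> \<le> C"
      proof (cases "c = 0")
        case True
        then show ?thesis using up[OF x] C by (intro that[of 0]) auto
      next
        case False
        then show ?thesis using up[OF x]
          by (intro that[of "(u x - p x) / c"]) (auto simp: abs_divide divide_le_eq)
      qed
      obtain b where b: "t = c * b" "\<bar>b\<bar> \<le> C"
      proof (cases "c = 0")
        case True
        then show ?thesis using kh C by (intro that[of 0]) (auto simp: t_def)
      next
        case False
        then show ?thesis using kh
          by (intro that[of "t / c"]) (auto simp: abs_divide divide_le_eq t_def)
      qed
      have ux: "u x = p x + c * a" using a by simp
      have "pot \<kappa> k c x - pot \<kappa> h 0 x = \<kappa>\<^sup>2 * (t * (x + c)\<^sup>2 + h\<^sup>2 * c * (2 * x + c))"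
        unfolding pot_def t_def by (simp add: algebra_simps power2_eq_square)
      then have e: "inverse (\<kappa>\<^sup>2 * h\<^sup>2) * (X x * (pot \<kappa> k c x - pot \<kappa> h 0 x) * u x - 2 * \<kappa>\<^sup>2 * h\<^sup>2 * x * p x * u x)
          = X x * (t * (1 / h\<^sup>2) * (x + c)\<^sup>2 + c * (2 * x + c)) * u x - 2 * x * p x * u x"
        using \<kappa> h by (simp add: field_simps)
      have "R x = c\<^sup>2 * (a * (u x + p x) + x * (a * a)
          + b * (1 / h\<^sup>2) * X x * (x * x * a + (2 * x + c) * u x) + X x * (2 * x * a + u x))"
        unfolding R_def e unfolding ux b(1) by (simp only: algebra_simps power2_eq_square mult_1_left mult_2)
      moreover have "\<bar>a * (u x + p x) + x * (a * a)
          + b * (1 / h\<^sup>2) * X x * (x * x * a + (2 * x + c) * u x) + X x * (2 * x * a + u x)\<bar> \<le> K"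
      proof -
        have "C * \<bar>c\<bar> \<le> C" using c(2) C by simp
        then have u': "\<bar>u x\<bar> \<le> S'" using up[OF x] S[OF x] unfolding S'_def by linarith
        have x': "\<bar>x\<bar> \<le> d" using x by auto
        have h': "\<bar>1 / h\<^sup>2\<bar> \<le> 1 / h\<^sup>2" using h by simp
        show ?thesis
          unfolding K_def
          by (intro abs_add_le_add abs_mult_le_mult a(2) b(2) u' x' h' S[OF x] Y[OF x] c(2)) auto
      qed
      moreover have "\<bar>c\<^sup>2 * Q\<bar> \<le> K * c\<^sup>2" if "\<bar>Q\<bar> \<le> K" for Q
        using mult_left_mono[OF that, of "c\<^sup>2"] by (simp add: abs_mult mult.commute)
      ultimately show ?thesis by simp
    qed
    have K0: "0 \<le> K * c\<^sup>2" using Rbd[of d] norm_ge_zero[of "R d"] d by simp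
    show ?thesis
      using has_integral_bound_real[OF K0 finite.emptyI Rint] Rbd d by simp
  qed
  \<comment> \<open>The quadratic bound at \<open>c = 0\<close> already forces
    \<open>I(0) = 0\<close>.\<close>
  have I0: "I_fun \<kappa> d 0 = 0" using main[of 0] \<delta> by simp
  have "((\<lambda>c. (I_fun \<kappa> d (0 + c) - I_fun \<kappa> d 0) / c - D) \<longlongrightarrow> 0) (at 0)"
  proof (rule Lim_null_comparison)
    have "\<forall>\<^sub>F c in at 0. \<bar>c\<bar> < min \<delta> 1"
      using \<delta> by (auto simp: eventually_at intro!: exI[of _ "min \<delta> 1"])
    moreover have "\<forall>\<^sub>F c :: real in at 0. c \<noteq> 0" by (simp add: eventually_at_filter)
    ultimately show "\<forall>\<^sub>F c in at 0. norm ((I_fun \<kappa> d (0 + c) - I_fun \<kappa> d 0) / c - D) \<le> K * (2 * d) * \<bar>c\<bar>"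
    proof eventually_elim
      case (elim c)
      have "norm ((I_fun \<kappa> d (0 + c) - I_fun \<kappa> d 0) / c - D) = \<bar>I_fun \<kappa> d c - c * D\<bar> / \<bar>c\<bar>"
        using elim I0 by (simp add: abs_divide[symmetric] diff_divide_distrib)
      also have "\<dots> \<le> K * c\<^sup>2 * (2 * d) / \<bar>c\<bar>"
        using main[of c] elim by (intro divide_right_mono) auto
      also have "\<dots> = K * (2 * d) * \<bar>c\<bar>"
        using elim by (simp add: field_simps power2_eq_square)
      finally show ?case .
    qed
    show "((\<lambda>c. K * (2 * d) * \<bar>c\<bar>) \<longlongrightarrow> 0) (at 0)"
      by (auto intro!: tendsto_eq_intros)
  qed
  then show ?thesis unfolding DERIV_def by (rule LIM_zero_cancel)
qed

lemma pot_deriv: "(pot \<kappa> h 0 has_real_derivative 2 * \<kappa>\<^sup>2 * h\<^sup>2 * x) (at x)"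
proof -
  have "((\<lambda>x. \<kappa>\<^sup>2 * (h\<^sup>2 * (x + 0)\<^sup>2 - 1)) has_real_derivative 2 * \<kappa>\<^sup>2 * h\<^sup>2 * x) (at x)"
    by (auto intro!: derivative_eq_intros)
  then show ?thesis unfolding pot_def[abs_def] .
qed

section \<open>The explicit formula for the derivative\<close>

text \<open>The normalisation at \<open>d\<close> agrees with the required one at \<open>-d\<close>,
  because \<open>p\<close> is even.\<close>

locale ground_state =
  fixes \<kappa> d h :: real and p p' w w' :: "real \<Rightarrow> real"
  assumes d: "d > 0" and \<kappa>: "\<kappa> > 0" and h: "h > 0"
    and p: "ode_sol (pot \<kappa> h 0) p p'" and ppos: "\<And>x. x \<in> {-d..d} \<Longrightarrow> p x > 0"
    and p_init: "p d = 1" "p' d = 0" "p' 0 = 0"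
    and w: "ode_sol (pot \<kappa> h 0) w w'" and w_init: "w 0 = 0" "w' 0 = 1"
begin

abbreviation "V \<equiv> pot \<kappa> h 0"

lemma p_even: "p (- x) = p x" "p' (- x) = - p' x"
  by (rule ode_sol_even[OF p continuous_on_pot pot_even p_init(3)])+

lemma w_odd: "w (- x) = - w x" "w' (- x) = w' x"
  by (rule ode_sol_odd[OF w continuous_on_pot pot_even w_init(1)])+

text \<open>Both functions solve the same equation, so the Wronskian is constant; its value is read
  off at 0.\<close>

lemma wronskian: "p x * w' x - w x * p' x = p 0"
proof -
  have "((\<lambda>x. p x * w' x - w x * p' x) has_real_derivative (V y - V y) * p y * w y) (at y)" for y
    by (intro wronskian_deriv ode_sol_deriv[OF p] ode_sol_deriv[OF w])
  then have "\<forall>y. ((\<lambda>x. p x * w' x - w x * p' x) has_real_derivative 0) (at y)" by simp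
  from DERIV_isconst_all[OF this, of x 0] show ?thesis using w_init by simp
qed

lemma p0_pos: "p 0 > 0" and w'_d: "w' d = p 0"
  using ppos[of 0] d wronskian[of d] p_init by simp_all

lemma I_fun_derivative:
  "(I_fun \<kappa> d has_real_derivative 2 * (d - (V d)\<^sup>2 * w d / (\<kappa>\<^sup>2 * h\<^sup>2 * p 0))) (at 0)"
proof -
  \<comment> \<open>At \<open>d\<close>, \<open>X'\<close> equals \<open>V(d) p(d) + B w'(d)\<close>
    with \<open>p(d) = 1\<close> and \<open>w'(d) = p(0)\<close>; this \<open>B\<close> makes it
    vanish.\<close>
  define B where "B = - V d / p 0"
  define X where "X x = p' x + B * w x" for x
  define X' where "X' x = V x * p x + B * w' x" for x
  \<comment> \<open>The first term differentiates to \<open>p^2 + 2 x p p'\<close>. In the second,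
    \<open>(w V p - w' p')' = V' w p\<close> and \<open>V' = 2 \<kappa>^2 h^2 x\<close>, which gives
    the part with \<open>B w\<close>.\<close>
  define G where "G x = x * (p x)\<^sup>2 + B / (\<kappa>\<^sup>2 * h\<^sup>2) * (w x * (V x * p x) - w' x * p' x)" for x
  note p_der = ode_sol_deriv[OF p] and w_der = ode_sol_deriv[OF w]
  have X: "(X has_real_derivative X' x) (at x)" for x
    unfolding X_def X'_def by (intro DERIV_add DERIV_cmult p_der w_der)
  have X': "(X' has_real_derivative V x * X x + 2 * \<kappa>\<^sup>2 * h\<^sup>2 * x * p x) (at x)" for x
  proof -
    have "(X' has_real_derivative (2 * \<kappa>\<^sup>2 * h\<^sup>2 * x * p x + p' x * V x) + B * (V x * w x)) (at x)"
      unfolding X'_def by (intro DERIV_add DERIV_cmult DERIV_mult pot_deriv p_der w_der)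
    then show ?thesis unfolding X_def by (simp add: algebra_simps)
  qed
  have X'd: "X' d = 0" unfolding X'_def B_def using p_init w'_d p0_pos by simp
  have X'md: "X' (- d) = 0" using X'd unfolding X'_def by (simp add: p_even w_odd pot_even)
  have X_odd: "X (- x) = - X x" for x unfolding X_def by (simp add: p_even w_odd)
  have "(G has_real_derivative (p x)\<^sup>2 + 2 * x * X x * p x) (at x)" for x
  proof -
    have "(G has_real_derivative (1 * (p x)\<^sup>2 + (2 * (p x) ^ 1 * p' x) * x)
      + B / (\<kappa>\<^sup>2 * h\<^sup>2) * ((w' x * (V x * p x) + (2 * \<kappa>\<^sup>2 * h\<^sup>2 * x * p x + p' x * V x) * w x)
        - (V x * w x * p' x + V x * p x * w' x))) (at x)"
      unfolding G_def
      by (intro DERIV_add DERIV_diff DERIV_cmult DERIV_mult DERIV_ident pot_deriv p_der w_der)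
        (auto intro!: derivative_eq_intros p_der)
    moreover have "(w' x * (V x * p x) + (2 * \<kappa>\<^sup>2 * h\<^sup>2 * x * p x + p' x * V x) * w x)
        - (V x * w x * p' x + V x * p x * w' x) = (\<kappa>\<^sup>2 * h\<^sup>2) * (2 * x * p x * w x)"
      by (simp add: algebra_simps)
    ultimately show ?thesis using \<kappa> h unfolding X_def by (simp add: algebra_simps)
  qed
  then have "((\<lambda>x. (p x)\<^sup>2 + 2 * x * X x * p x) has_integral (G d - G (-d))) {-d..d}"
    using d by (intro fundamental_theorem_of_calculus)
      (auto simp: has_real_derivative_iff_has_vector_derivative[symmetric]
        intro: has_field_derivative_at_within)
  moreover have "G d - G (-d) = 2 * (d - (V d)\<^sup>2 * w d / (\<kappa>\<^sup>2 * h\<^sup>2 * p 0))"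
    unfolding G_def B_def by (simp add: p_even w_odd pot_even p_init power2_eq_square mult_ac)
  ultimately have int: "((\<lambda>x. (p x)\<^sup>2 + 2 * x * X x * p x) has_integral
      2 * (d - (V d)\<^sup>2 * w d / (\<kappa>\<^sup>2 * h\<^sup>2 * p 0))) {-d..d}" by simp
  have bd: "p (-d) = 1" "p' (-d) = 0" using p_init by (simp_all add: p_even)
  show ?thesis
    by (rule I_fun_has_derivative_at_0[OF d \<kappa> h p ppos bd p_init(2) p_even(1) X X' X'md X'd X_odd int])
qed

section \<open>Monotonicity of the ground state and bounds on \<open>h * d\<close>\<close>

lemma V_mono: "0 \<le> x \<Longrightarrow> x \<le> y \<Longrightarrow> V x \<le> V y"
  unfolding pot_def by (intro mult_left_mono diff_right_mono power_mono) auto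

text \<open>\<open>V\<close> increases on \<open>[0,d]\<close>, so \<open>p'' = V p\<close> turns at
  most once from nonpositive to nonnegative: \<open>p'\<close> first falls from 0 and then rises
  back to 0. The case split decides from which end to integrate.\<close>

lemma p'_nonpos:
  assumes x: "x \<in> {0..d}"
  shows "p' x \<le> 0"
proof (cases "V x \<le> 0")
  case True
  have "p' 0 \<ge> p' x"
  proof (rule DERIV_nonpos_imp_nonincreasing[where f = p'])
    fix t assume t: "0 \<le> t" "t \<le> x"
    have "V t * p t \<le> 0" using V_mono[OF t] True ppos[of t] t x by (simp add: mult_nonpos_nonneg)
    then show "\<exists>y. (p' has_real_derivative y) (at t) \<and> y \<le> 0" using ode_sol_deriv(2)[OF p] by blast
  qed (use x in auto)
  then show ?thesis using p_init by simp
next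
  case False
  have "p' x \<le> p' d"
  proof (rule DERIV_nonneg_imp_nondecreasing[where f = p'])
    fix t assume t: "x \<le> t" "t \<le> d"
    have "V t * p t \<ge> 0" using V_mono[of x t] False ppos[of t] t x by simp
    then show "\<exists>y. (p' has_real_derivative y) (at t) \<and> 0 \<le> y" using ode_sol_deriv(2)[OF p] by blast
  qed (use x in auto)
  then show ?thesis using p_init by simp
qed

lemma p_antimono: "0 \<le> x \<Longrightarrow> x \<le> y \<Longrightarrow> y \<le> d \<Longrightarrow> p y \<le> p x"
  using p'_nonpos ode_sol_deriv(1)[OF p]
  by (intro DERIV_nonpos_imp_nonincreasing[where f = p]) force+

text \<open>Riccati substitution: \<open>(p'/p)' = V - (p'/p)\<^sup>2 \<le> V\<close>, so \<open>V\<close> has nonnegative mean.\<close>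
lemma hd_ge: "(h * d)\<^sup>2 \<ge> 3"
proof -
  define F where "F x = p' x / p x - \<kappa>\<^sup>2 * (h\<^sup>2 * (x ^ 3 / 3) - x)" for x
  have "F d \<le> F 0"
  proof (rule DERIV_nonpos_imp_nonincreasing[where f = F])
    fix x assume "0 \<le> x" "x \<le> d"
    then have px: "p x > 0" using ppos by simp
    have "((\<lambda>x. p' x / p x) has_real_derivative V x - (p' x / p x)\<^sup>2) (at x)"
      using px by (auto intro!: derivative_eq_intros ode_sol_deriv[OF p] simp: field_simps power2_eq_square)
    moreover have "((\<lambda>x. \<kappa>\<^sup>2 * (h\<^sup>2 * (x ^ 3 / 3) - x)) has_real_derivative V x) (at x)"
      unfolding pot_def by (auto intro!: derivative_eq_intros simp: power2_eq_square)
    ultimately have "(F has_real_derivative V x - (p' x / p x)\<^sup>2 - V x) (at x)"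
      unfolding F_def by (rule DERIV_diff)
    then show "\<exists>y. (F has_real_derivative y) (at x) \<and> y \<le> 0"
      by (intro exI[of _ "V x - (p' x / p x)\<^sup>2 - V x"]) simp
  qed (use d in simp)
  then have "0 \<le> \<kappa>\<^sup>2 * (h\<^sup>2 * (d ^ 3 / 3) - d)" unfolding F_def using p_init by simp
  then have "0 \<le> h\<^sup>2 * (d ^ 3 / 3) - d" using \<kappa> by (simp add: zero_le_mult_iff)
  then have "0 \<le> d * ((h * d)\<^sup>2 / 3 - 1)"
    by (simp add: algebra_simps power2_eq_square power3_eq_cube)
  then show ?thesis using d by (simp add: zero_le_mult_iff)
qed

text \<open>For \<open>\<kappa> d \<le> 1\<close>, integrating
  \<open>p'' \<ge> - \<kappa>^2 p(0)\<close> twice gives \<open>p \<ge> p(0) / 2\<close>. Weighting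
  the positive part of the potential by \<open>p(0) / 2\<close> and the negative part by
  \<open>p(0)\<close> then yields \<open>p'' \<ge> \<kappa>^2 p(0) ((h x)^2 / 2 - 1)\<close>, whose
  integral over \<open>[0,d]\<close> must be at most 0.\<close>

lemma hd_le:
  assumes \<kappa>d: "\<kappa> * d \<le> 1"
  shows "(h * d)\<^sup>2 \<le> 6"
proof -
  note p_der = ode_sol_deriv[OF p]
  have p_le: "p x \<le> p 0" if "x \<in> {0..d}" for x using p_antimono[of 0 x] that by simp
  have p'_ge: "p' x \<ge> - (\<kappa>\<^sup>2 * p 0) * x" if x: "x \<in> {0..d}" for x
  proof -
    have "p' 0 + \<kappa>\<^sup>2 * p 0 * 0 \<le> p' x + \<kappa>\<^sup>2 * p 0 * x"
    proof (rule DERIV_nonneg_imp_nondecreasing[where f = "\<lambda>x. p' x + \<kappa>\<^sup>2 * p 0 * x"])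
      fix t assume "0 \<le> t" "t \<le> x"
      then have t: "t \<in> {0..d}" using x by simp
      have der: "((\<lambda>x. p' x + \<kappa>\<^sup>2 * p 0 * x) has_real_derivative V t * p t + \<kappa>\<^sup>2 * p 0 * 1) (at t)"
        by (intro DERIV_add DERIV_cmult DERIV_ident p_der)
      have "V t * p t + \<kappa>\<^sup>2 * p 0 * 1 = \<kappa>\<^sup>2 * (h * t)\<^sup>2 * p t + \<kappa>\<^sup>2 * (p 0 - p t)"
        by (simp add: pot_def algebra_simps)
      also have "\<dots> \<ge> 0" using p_le[OF t] ppos[of t] t by simp
      finally show "\<exists>y. ((\<lambda>x. p' x + \<kappa>\<^sup>2 * p 0 * x) has_real_derivative y) (at t) \<and> 0 \<le> y"
        using der by blast
    qed (use x in auto)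
    then show ?thesis using p_init by simp
  qed
  have p_ge: "p x \<ge> p 0 / 2" if x: "x \<in> {0..d}" for x
  proof -
    have "p 0 + \<kappa>\<^sup>2 * p 0 / 2 * 0\<^sup>2 \<le> p x + \<kappa>\<^sup>2 * p 0 / 2 * x\<^sup>2"
    proof (rule DERIV_nonneg_imp_nondecreasing[where f = "\<lambda>x. p x + \<kappa>\<^sup>2 * p 0 / 2 * x\<^sup>2"])
      fix t assume "0 \<le> t" "t \<le> x"
      then have t: "t \<in> {0..d}" using x by simp
      have "((\<lambda>x. x\<^sup>2) has_real_derivative 2 * t) (at t)" by (auto intro!: derivative_eq_intros)
      then have "((\<lambda>x. p x + \<kappa>\<^sup>2 * p 0 / 2 * x\<^sup>2) has_real_derivative p' t + \<kappa>\<^sup>2 * p 0 / 2 * (2 * t)) (at t)"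
        by (intro DERIV_add DERIV_cmult p_der)
      moreover have "p' t + \<kappa>\<^sup>2 * p 0 / 2 * (2 * t) \<ge> 0" using p'_ge[OF t] by simp
      ultimately show "\<exists>y. ((\<lambda>x. p x + \<kappa>\<^sup>2 * p 0 / 2 * x\<^sup>2) has_real_derivative y) (at t) \<and> 0 \<le> y"
        by blast
    qed (use x in auto)
    moreover have "\<kappa>\<^sup>2 * p 0 / 2 * x\<^sup>2 \<le> p 0 / 2"
    proof -
      have "\<kappa> * x \<le> \<kappa> * d" using x \<kappa> by simp
      also note \<kappa>d
      finally have "(\<kappa> * x)\<^sup>2 \<le> 1" using x \<kappa> by (intro power_le_one) auto
      then have "p 0 / 2 * (\<kappa> * x)\<^sup>2 \<le> p 0 / 2 * 1" using p0_pos by (intro mult_left_mono) auto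
      then show ?thesis by (simp add: power_mult_distrib mult_ac)
    qed
    ultimately show ?thesis by simp
  qed
  define F where "F x = p' x - \<kappa>\<^sup>2 * p 0 * (h\<^sup>2 * (x ^ 3 / 6) - x)" for x
  have "F 0 \<le> F d"
  proof (rule DERIV_nonneg_imp_nondecreasing[where f = F])
    fix x assume "0 \<le> x" "x \<le> d"
    then have x: "x \<in> {0..d}" by simp
    have cubic: "((\<lambda>x. h\<^sup>2 * (x ^ 3 / 6) - x) has_real_derivative (h * x)\<^sup>2 / 2 - 1) (at x)"
      by (auto intro!: derivative_eq_intros simp: power2_eq_square)
    have der: "(F has_real_derivative V x * p x - \<kappa>\<^sup>2 * p 0 * ((h * x)\<^sup>2 / 2 - 1)) (at x)"
      unfolding F_def by (rule DERIV_diff[OF p_der(2) DERIV_cmult[OF cubic]])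
    have "V x * p x - \<kappa>\<^sup>2 * p 0 * ((h * x)\<^sup>2 / 2 - 1)
        = \<kappa>\<^sup>2 * (h * x)\<^sup>2 * (p x - p 0 / 2) + \<kappa>\<^sup>2 * (p 0 - p x)"
      by (simp add: pot_def algebra_simps)
    also have "\<dots> \<ge> 0" using p_le[OF x] p_ge[OF x] by simp
    finally show "\<exists>y. (F has_real_derivative y) (at x) \<and> 0 \<le> y" using der by blast
  qed (use d in simp)
  then have "\<kappa>\<^sup>2 * p 0 * (h\<^sup>2 * (d ^ 3 / 6) - d) \<le> 0" unfolding F_def using p_init by simp
  then have "h\<^sup>2 * (d ^ 3 / 6) - d \<le> 0" using \<kappa> p0_pos by (simp add: mult_le_0_iff)
  then have "d * ((h * d)\<^sup>2 / 6 - 1) \<le> 0"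
    by (simp add: algebra_simps power2_eq_square power3_eq_cube)
  then show ?thesis using d by (simp add: mult_le_0_iff)
qed

section \<open>Bounds on the odd solution at the end point\<close>

text \<open>Reduction of order: the numerator of the quotient rule is the constant
  Wronskian.\<close>

lemma w_over_p_deriv:
  assumes "x \<in> {0..d}"
  shows "((\<lambda>x. w x / p x) has_real_derivative p 0 / (p x)\<^sup>2) (at x)"
proof -
  have px: "p x > 0" using ppos[of x] assms d by simp
  have "((\<lambda>x. w x / p x) has_real_derivative (w' x * p x - w x * p' x) / (p x * p x)) (at x)"
    using px by (intro DERIV_divide ode_sol_deriv[OF p] ode_sol_deriv[OF w]) simp
  then show ?thesis using wronskian[of x] by (simp add: power2_eq_square mult.commute)
qed

lemma p_ge_1: "x \<in> {0..d} \<Longrightarrow> p x \<ge> 1"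
  using p_antimono[of x d] p_init by simp

text \<open>On \<open>[0,d]\<close> one has \<open>p \<ge> 1\<close>, so \<open>w / p\<close> grows
  at rate at most \<open>p(0)\<close>.\<close>

lemma w_d_le: "w d \<le> p 0 * d"
proof -
  have "w 0 / p 0 - p 0 * 0 \<ge> w d / p d - p 0 * d"
  proof (rule DERIV_nonpos_imp_nonincreasing[where f = "\<lambda>x. w x / p x - p 0 * x"])
    fix x assume "0 \<le> x" "x \<le> d"
    then have x: "x \<in> {0..d}" by simp
    have der: "((\<lambda>x. w x / p x - p 0 * x) has_real_derivative p 0 / (p x)\<^sup>2 - p 0 * 1) (at x)"
      by (intro DERIV_diff DERIV_cmult DERIV_ident w_over_p_deriv x)
    have "p 0 / (p x)\<^sup>2 \<le> p 0 / 1"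
      using p_ge_1[OF x] p0_pos by (intro divide_left_mono) (auto simp: one_le_power)
    then show "\<exists>y. ((\<lambda>x. w x / p x - p 0 * x) has_real_derivative y) (at x) \<and> y \<le> 0"
      using der by (intro exI[of _ "p 0 / (p x)\<^sup>2 - p 0 * 1"]) simp
  qed (use d in simp)
  then show ?thesis using w_init p_init by simp
qed

text \<open>Since \<open>p\<close> decreases, \<open>p \<le> P\<close> on all of
  \<open>[a,b]\<close>, so \<open>w / p\<close> grows there at rate at least
  \<open>p(0) / P^2\<close>.\<close>

lemma w_over_p_mono:
  assumes "0 \<le> a" "a \<le> b" "b \<le> d" and P: "p a \<le> P"
  shows "w a / p a + p 0 / P\<^sup>2 * (b - a) \<le> w b / p b"
proof -
  have "w a / p a - p 0 / P\<^sup>2 * a \<le> w b / p b - p 0 / P\<^sup>2 * b"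
  proof (rule DERIV_nonneg_imp_nondecreasing[where f = "\<lambda>x. w x / p x - p 0 / P\<^sup>2 * x"])
    fix x assume x': "a \<le> x" "x \<le> b"
    then have x: "x \<in> {0..d}" using assms by simp
    have der: "((\<lambda>x. w x / p x - p 0 / P\<^sup>2 * x) has_real_derivative p 0 / (p x)\<^sup>2 - p 0 / P\<^sup>2 * 1) (at x)"
      by (intro DERIV_diff DERIV_cmult DERIV_ident w_over_p_deriv x)
    have "1 \<le> p x" "p x \<le> P"
      using p_ge_1[OF x] p_antimono[of a x] assms x' by auto
    then have "p 0 / P\<^sup>2 \<le> p 0 / (p x)\<^sup>2"
      using p0_pos by (intro divide_left_mono power_mono mult_pos_pos zero_less_power) auto
    then show "\<exists>y. ((\<lambda>x. w x / p x - p 0 / P\<^sup>2 * x) has_real_derivative y) (at x) \<and> 0 \<le> y"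
      using der by (intro exI[of _ "p 0 / (p x)\<^sup>2 - p 0 / P\<^sup>2 * 1"]) simp
  qed (use assms in simp)
  then show ?thesis by (simp add: right_diff_distrib)
qed

text \<open>In the layer of width \<open>e\<close> below \<open>d\<close>, \<open>p\<close> stays at
  most 2, so \<open>w / p\<close> gains at least \<open>e p(0) / 4\<close> there; it enters the
  layer with a nonnegative value.\<close>

lemma w_d_ge:
  assumes e: "0 < e" "e \<le> d" and Ve: "V d * e\<^sup>2 \<le> 1 / 2" and V0: "V d \<ge> 0"
  shows "w d \<ge> e * p 0 / 4"
proof -
  define P where "P = p (d - e)"
  have P1: "P \<ge> 1" unfolding P_def using e by (intro p_ge_1) auto
  have p'_ge: "p' x \<ge> - (V d * P) * e" if x: "x \<in> {d - e..d}" for x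
  proof -
    have "p' x - V d * P * x \<ge> p' d - V d * P * d"
    proof (rule DERIV_nonpos_imp_nonincreasing[where f = "\<lambda>x. p' x - V d * P * x"])
      fix t assume t: "x \<le> t" "t \<le> d"
      have der: "((\<lambda>x. p' x - V d * P * x) has_real_derivative V t * p t - V d * P * 1) (at t)"
        by (intro DERIV_diff DERIV_cmult DERIV_ident ode_sol_deriv[OF p])
      have "V t \<le> V d" using t x e by (intro V_mono) auto
      moreover have "p t \<le> P" "p t > 0"
        unfolding P_def using t x e ppos[of t] by (auto intro!: p_antimono)
      ultimately have "V t * p t \<le> V d * P" using V0 by (intro mult_mono) auto
      then show "\<exists>y. ((\<lambda>x. p' x - V d * P * x) has_real_derivative y) (at t) \<and> y \<le> 0"
        using der by (intro exI[of _ "V t * p t - V d * P * 1"]) simp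
    qed (use x in simp)
    then have "p' x \<ge> - (V d * P) * (d - x)" using p_init by (simp add: algebra_simps)
    moreover have "V d * P * (d - x) \<le> V d * P * e" using x V0 P1 by (intro mult_left_mono) auto
    ultimately show ?thesis by simp
  qed
  \<comment> \<open>Second integration of \<open>p'' \<le> V(d) P\<close> across the layer, giving
    \<open>P \<le> 1 + P V(d) e^2\<close>; with \<open>V(d) e^2 \<le> 1 / 2\<close> this closes to
    \<open>P \<le> 2\<close>.\<close>
  have "P + V d * P * e * (d - e) \<le> p d + V d * P * e * d"
    unfolding P_def
  proof (rule DERIV_nonneg_imp_nondecreasing[where f = "\<lambda>x. p x + V d * p (d - e) * e * x"])
    fix x assume x: "d - e \<le> x" "x \<le> d"
    have der: "((\<lambda>x. p x + V d * p (d - e) * e * x) has_real_derivative p' x + V d * p (d - e) * e * 1) (at x)"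
      by (intro DERIV_add DERIV_cmult DERIV_ident ode_sol_deriv[OF p])
    moreover have "p' x + V d * p (d - e) * e * 1 \<ge> 0" using p'_ge[of x] x unfolding P_def by simp
    ultimately show "\<exists>y. ((\<lambda>x. p x + V d * p (d - e) * e * x) has_real_derivative y) (at x) \<and> 0 \<le> y"
      by blast
  qed (use e in simp)
  then have "P \<le> 1 + P * (V d * e\<^sup>2)" using p_init by (simp add: algebra_simps power2_eq_square)
  also have "P * (V d * e\<^sup>2) \<le> P * (1 / 2)" using Ve P1 by (intro mult_left_mono) auto
  finally have P2: "P \<le> 2" by simp
  have "w 0 / p 0 + p 0 / (p 0)\<^sup>2 * (d - e - 0) \<le> w (d - e) / p (d - e)"
    using e by (intro w_over_p_mono) auto
  moreover have "p 0 / (p 0)\<^sup>2 * (d - e - 0) \<ge> 0" using e p0_pos by simp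
  ultimately have "w (d - e) / p (d - e) \<ge> 0" using w_init by simp
  moreover have "w (d - e) / p (d - e) + p 0 / 2\<^sup>2 * (d - (d - e)) \<le> w d / p d"
    using e P2 unfolding P_def by (intro w_over_p_mono) auto
  ultimately show ?thesis using p_init by (simp add: mult.commute)
qed

section \<open>Sign of the derivative in the two regimes\<close>

lemma V_d: "V d = \<kappa>\<^sup>2 * ((h * d)\<^sup>2 - 1)"
  by (simp add: pot_def power_mult_distrib)

text \<open>By \<open>w(d) \<le> p(0) d\<close> it suffices that
  \<open>V(d)^2 < \<kappa>^2 h^2\<close>, that is \<open>(\<kappa> d)^2 (H - 1)^2 < H\<close>. With
  \<open>3 \<le> H \<le> 6\<close> and \<open>\<kappa> d < 1 / 4\<close> the left side is at most
  \<open>25 / 16\<close>.\<close>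

lemma derivative_pos:
  assumes "\<kappa> * d < 1 / 4"
  shows "d - (V d)\<^sup>2 * w d / (\<kappa>\<^sup>2 * h\<^sup>2 * p 0) > 0"
proof -
  define H where "H = (h * d)\<^sup>2"
  have H: "3 \<le> H" "H \<le> 6" unfolding H_def using hd_ge hd_le assms by auto
  have "(\<kappa> * d)\<^sup>2 \<le> (1 / 4)\<^sup>2" using assms \<kappa> d by (intro power_mono) auto
  moreover have "(H - 1)\<^sup>2 \<le> 5\<^sup>2" using H by (intro power_mono) auto
  ultimately have "(\<kappa> * d)\<^sup>2 * (H - 1)\<^sup>2 \<le> (1 / 4)\<^sup>2 * 5\<^sup>2" by (intro mult_mono) auto
  then have "(\<kappa> * d)\<^sup>2 * (H - 1)\<^sup>2 < H" using H by (simp add: power2_eq_square)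
  then have "d\<^sup>2 * (\<kappa>\<^sup>2 * (H - 1)\<^sup>2) < d\<^sup>2 * h\<^sup>2"
    by (simp add: H_def power_mult_distrib mult_ac)
  then have less: "\<kappa>\<^sup>2 * (H - 1)\<^sup>2 < h\<^sup>2" using d by simp
  have "(V d)\<^sup>2 = \<kappa>\<^sup>2 * (\<kappa>\<^sup>2 * (H - 1)\<^sup>2)"
    unfolding V_d H_def by (simp add: power_mult_distrib power2_eq_square mult_ac)
  also have "\<dots> < \<kappa>\<^sup>2 * h\<^sup>2" using less \<kappa> by (intro mult_strict_left_mono) auto
  finally have V2: "(V d)\<^sup>2 < \<kappa>\<^sup>2 * h\<^sup>2" .
  have "(V d)\<^sup>2 * w d \<le> (V d)\<^sup>2 * (p 0 * d)" using w_d_le by (intro mult_left_mono) auto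
  also have "\<dots> < (\<kappa>\<^sup>2 * h\<^sup>2) * (p 0 * d)" using V2 p0_pos d by (intro mult_strict_right_mono) auto
  finally have "(V d)\<^sup>2 * w d < d * (\<kappa>\<^sup>2 * h\<^sup>2 * p 0)" by (simp add: mult_ac)
  then have "(V d)\<^sup>2 * w d / (\<kappa>\<^sup>2 * h\<^sup>2 * p 0) < d"
    using \<kappa> h p0_pos by (subst pos_divide_less_eq) auto
  then show ?thesis by simp
qed

lemma derivative_neg:
  assumes "\<kappa> * d > 6"
  shows "d - (V d)\<^sup>2 * w d / (\<kappa>\<^sup>2 * h\<^sup>2 * p 0) < 0"
proof -
  define H where "H = (h * d)\<^sup>2"
  have H: "3 \<le> H" unfolding H_def using hd_ge .
  have VH: "V d = \<kappa>\<^sup>2 * (H - 1)" unfolding V_d H_def ..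
  have V_ge: "V d \<ge> 2 * \<kappa>\<^sup>2" "V d \<ge> 2 / 3 * (\<kappa>\<^sup>2 * H)"
  proof -
    have "\<kappa>\<^sup>2 * (H - 1) \<ge> \<kappa>\<^sup>2 * 2" "\<kappa>\<^sup>2 * (H - 1) \<ge> \<kappa>\<^sup>2 * (2 / 3 * H)"
      using H by (intro mult_left_mono; simp)+
    then show "V d \<ge> 2 * \<kappa>\<^sup>2" "V d \<ge> 2 / 3 * (\<kappa>\<^sup>2 * H)" unfolding VH by simp_all
  qed
  have "\<kappa>\<^sup>2 > 0" using \<kappa> by simp
  then have V0: "V d > 0" using V_ge(1) by linarith
  \<comment> \<open>The widest layer allowed by the lower bound on \<open>w(d)\<close>:
    \<open>V(d) e^2\<close> is exactly \<open>1 / 2\<close>.\<close>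
  define e where "e = 1 / sqrt (2 * V d)"
  have e0: "e > 0" unfolding e_def using V0 by simp
  have e2: "V d * e\<^sup>2 = 1 / 2" unfolding e_def using V0 by (simp add: power_divide)
  \<comment> \<open>From \<open>\<kappa> d > 6\<close> and \<open>V(d) \<ge> 2 \<kappa>^2\<close>
    one gets \<open>V(d) d^2 > 72 = V(d) (12 e)^2\<close>.\<close>
  have "(12 * e)\<^sup>2 < d\<^sup>2"
  proof -
    have "6\<^sup>2 < (\<kappa> * d)\<^sup>2" using assms by (intro power_strict_mono) auto
    then have "72 < 2 * \<kappa>\<^sup>2 * d\<^sup>2" by (simp add: power_mult_distrib)
    also have "\<dots> \<le> V d * d\<^sup>2" using V_ge(1) by (intro mult_right_mono) auto
    finally have "V d * (12 * e)\<^sup>2 < V d * d\<^sup>2" using e2 by (simp add: power_mult_distrib)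
    then show ?thesis using V0 by simp
  qed
  then have ed: "12 * e < d" using d by (rule power2_less_imp_less[OF _ less_imp_le])
  have wge: "w d \<ge> e * p 0 / 4"
    using ed e0 V0 e2 by (intro w_d_ge) auto
  \<comment> \<open>The target inequality is multiplied by \<open>12 e\<close>: the left side stays
    below \<open>\<kappa>^2 H \<le> 3 V(d) / 2\<close>, which by the choice of \<open>e\<close> is
    exactly the right side. This fixes the factor 12 and with it the threshold 6.\<close>
  have "d * (\<kappa>\<^sup>2 * h\<^sup>2) * (12 * e) < d * (\<kappa>\<^sup>2 * h\<^sup>2) * d"
    using ed \<kappa> h d by (intro mult_strict_left_mono) auto
  also have "\<dots> = \<kappa>\<^sup>2 * H" by (simp add: H_def power2_eq_square)
  also have "\<dots> \<le> 3 / 2 * V d" using V_ge(2) by simp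
  also have "\<dots> = 3 * V d * (V d * e\<^sup>2)" unfolding e2 by simp
  also have "\<dots> = ((V d)\<^sup>2 * (e / 4)) * (12 * e)" by (simp add: power2_eq_square)
  finally have "d * (\<kappa>\<^sup>2 * h\<^sup>2) < (V d)\<^sup>2 * (e / 4)"
    by (rule mult_right_less_imp_less) (use e0 in simp)
  then have "d * (\<kappa>\<^sup>2 * h\<^sup>2) * p 0 < (V d)\<^sup>2 * (e / 4) * p 0"
    using p0_pos by (intro mult_strict_right_mono)
  also have "\<dots> = (V d)\<^sup>2 * (e * p 0 / 4)" by simp
  also have "\<dots> \<le> (V d)\<^sup>2 * w d" using wge by (intro mult_left_mono) auto
  finally have "d * (\<kappa>\<^sup>2 * h\<^sup>2 * p 0) < (V d)\<^sup>2 * w d" by (simp add: mult_ac)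
  then have "d < (V d)\<^sup>2 * w d / (\<kappa>\<^sup>2 * h\<^sup>2 * p 0)"
    using \<kappa> h p0_pos by (subst pos_less_divide_eq) auto
  then show ?thesis by simp
qed

end

theorem lemma2:
  "\<exists>k K :: real. 0 < k \<and> k < K \<and>
     (\<forall>\<kappa> d :: real. 0 < \<kappa> \<longrightarrow> 0 < d \<longrightarrow>
        (\<kappa> * d < k \<longrightarrow> (\<exists>D. (I_fun \<kappa> d has_real_derivative D) (at 0) \<and> D > 0)) \<and>
        (\<kappa> * d > K \<longrightarrow> (\<exists>D. (I_fun \<kappa> d has_real_derivative D) (at 0) \<and> D < 0)))"
proof -
  have "(\<kappa> * d < 1 / 4 \<longrightarrow> (\<exists>D. (I_fun \<kappa> d has_real_derivative D) (at 0) \<and> D > 0)) \<and>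
        (\<kappa> * d > 6 \<longrightarrow> (\<exists>D. (I_fun \<kappa> d has_real_derivative D) (at 0) \<and> D < 0))"
    if \<kappa>: "0 < \<kappa>" and d: "0 < d" for \<kappa> d :: real
  proof -
    obtain h p p' where hp: "h > 0" "ode_sol (pot \<kappa> h 0) p p'" "\<forall>x\<in>{-d..d}. p x > 0"
      "p d = 1" "p' d = 0" "p' 0 = 0"
      using ground_state_exists[OF d \<kappa>] by blast
    obtain w w' where w: "ode_sol (pot \<kappa> h 0) w w'" "w 0 = 0" "w' 0 = 1"
      using ode_sol_pot_exists by blast
    interpret ground_state \<kappa> d h p p' w w'
      by unfold_locales (use \<kappa> d hp w in auto)
    show ?thesis
      using I_fun_derivative derivative_pos derivative_neg by (meson mult_pos_pos mult_pos_neg zero_less_numeral)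
  qed
  then show ?thesis by (intro exI[of _ "1 / 4"] exI[of _ 6]) auto
qed

end
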